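(* Let $\lambda=(\lambda_1,\dots,\lambda_m)$ be a partition of $N=\sum_{i=1}^m\lambda_i$, with $\lambda_1\ge\dots\ge\lambda_m\ge 1$, and let $T_\lambda=T_{\lambda_1}\times\dots\times T_{\lambda_m}$ be the associated product map. Then, as an identity of Dirichlet series in the complex variable $s$, $$\mathsf{d}_{T_\lambda}(s)=\prod_{p\ \mathrm{prime}}\frac{C_\lambda(p^{-1-s},p)}{\prod_{i=1}^{N}(1-p^{i-1-s})}=\prod_{p\ \mathrm{prime}}\frac{\sum_{w\in S_\lambda}p^{(-1-s)\operatorname{des}(w)+\operatorname{maj}(w)}}{\prod_{i=1}^{N}(1-p^{i-1-s})}.$$
   Context: Orbits. For a map $T:X\to X$, a closed orbit of length $n\in\mathbb{N}=\{1,2,\dots\}$ is a set $\{x,T(x),T^2(x),\dots,T^n(x)=x\}$ of cardinality $n$. Let $\mathsf{O}_T(n)$ be the number of closed orbits of length $n$, assumed finite for all $n$. The orbit Dirichlet series of $T$ is $\mathsf{d}_T(s)=\sum_{n=1}^\infty \mathsf{O}_T(n)n^{-s}$. The maps $T_r$ and $T_\lambda$. For $r\in\mathbb{N}$, $T_r$ denotes a map such that $\mathsf{O}_{T_r}(n)=a_n(\mathbb{Z}^r)$ for all $n\in\mathbb{N}$, where $a_n(\mathbb{Z}^r)$ is the number of subgroups of index $n$ in $\mathbb{Z}^r$; equivalently $\mathsf{d}_{T_r}(s)=\prod_{i=0}^{r-1}\zeta(s-i)$, with $\zeta$ the Riemann zeta function. For a partition $\lambda=(\lambda_1,\dots,\lambda_m)$,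 $T_\lambda=T_{\lambda_1}\times\dots\times T_{\lambda_m}$ is the Cartesian product map (acting coordinatewise on the product of the spaces). Multiset permutations. $S_\lambda$ is the set of all words $w=w_1\dots w_N$ formed from all $N$ elements of the multiset containing $\lambda_i$ indistinguishable copies of the letter $i$ for $i=1,\dots,m$, with letters ordered $1<2<\dots<m$. For $w\in S_\lambda$, $\operatorname{Des}(w)=\{i\in\{1,\dots,N-1\}\mid w_i>w_{i+1}\}$, $\operatorname{des}(w)=|\operatorname{Des}(w)|$, $\operatorname{maj}(w)=\sum_{i\in\operatorname{Des}(w)}i$. Finally $C_\lambda(x,q)=\sum_{w\in S_\lambda}x^{\operatorname{des}(w)}q^{\operatorname{maj}(w)}\in\mathbb{Z}[x,q]$. *)

theory Defs
  imports
    "HOL-Analysis.Analysis"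
    "HOL-Algebra.Product_Groups"
    "HOL-Computational_Algebra.Primes"
    "HOL-Combinatorics.Multiset_Permutations"
begin

text \<open>
  A space is a carrier set \<open>X\<close> inside a type, so that spaces of different sizes can occur together
  as factors of one product.  The last conjunct, with the cyclic condition, says that \<open>n\<close> is the
  exact length of the orbit; this is meant for \<open>n \<ge> 1\<close>.
\<close>

definition closed_orbits :: "'a set \<Rightarrow> ('a \<Rightarrow> 'a) \<Rightarrow> nat \<Rightarrow> 'a set set" where
  "closed_orbits X T n =
     {A. \<exists>x\<in>X. A = (\<lambda>k. (T ^^ k) x) ` {0..n} \<and> (T ^^ n) x = x \<and> card A = n}"

definition orbit_count :: "'a set \<Rightarrow> ('a \<Rightarrow> 'a) \<Rightarrow> nat \<Rightarrow> nat" where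
  "orbit_count X T n = card (closed_orbits X T n)"

definition orbit_dirichlet_term :: "'a set \<Rightarrow> ('a \<Rightarrow> 'a) \<Rightarrow> complex \<Rightarrow> nat \<Rightarrow> complex" where
  "orbit_dirichlet_term X T s n = of_nat (orbit_count X T n) * of_nat n powr (- s)"

text \<open>The shift by \<open>Suc\<close> makes the sum range over \<open>n \<ge> 1\<close>.\<close>

definition orbit_dirichlet_series :: "'a set \<Rightarrow> ('a \<Rightarrow> 'a) \<Rightarrow> complex \<Rightarrow> complex" where
  "orbit_dirichlet_series X T s = (\<Sum>n. orbit_dirichlet_term X T s (Suc n))"

definition int_lattice :: "nat \<Rightarrow> (nat \<Rightarrow> int) monoid" where
  "int_lattice r = product_group {..<r} (\<lambda>_. integer_group)"

text \<open>
  The number \<open>a\<^sub>n(\<int>\<^sup>r)\<close> of subgroups of index \<open>n\<close>.  For \<open>n \<ge> 1\<close> the convention that infinite sets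
  have cardinality \<open>0\<close> does not let subgroups of infinite index slip in.
\<close>

definition subgroup_count :: "nat \<Rightarrow> nat \<Rightarrow> nat" where
  "subgroup_count r n =
     card {H. subgroup H (int_lattice r) \<and> card (rcosets\<^bsub>int_lattice r\<^esub> H) = n}"

definition is_partition :: "nat list \<Rightarrow> nat \<Rightarrow> bool" where
  "is_partition lam N \<longleftrightarrow> sorted_wrt (\<ge>) lam \<and> (\<forall>r\<in>set lam. r \<ge> 1) \<and> sum_list lam = N"

text \<open>
  For a family of maps \<open>T r\<close> on spaces \<open>X r\<close>, the Cartesian product
  \<open>T \<lambda>\<^sub>1 \<times> \<dots> \<times> T \<lambda>\<^sub>m\<close>; list indices start at \<open>0\<close>, so \<open>\<lambda>\<^sub>i\<close> is \<open>lam ! (i - 1)\<close>.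
\<close>

definition product_space :: "(nat \<Rightarrow> 'a set) \<Rightarrow> nat list \<Rightarrow> (nat \<Rightarrow> 'a) set" where
  "product_space X lam = (\<Pi>\<^sub>E i\<in>{..<length lam}. X (lam ! i))"

definition product_map :: "(nat \<Rightarrow> 'a \<Rightarrow> 'a) \<Rightarrow> nat list \<Rightarrow> (nat \<Rightarrow> 'a) \<Rightarrow> (nat \<Rightarrow> 'a)" where
  "product_map T lam x = (\<lambda>i\<in>{..<length lam}. T (lam ! i) (x i))"

definition multiset_words :: "nat list \<Rightarrow> nat list set" where
  "multiset_words lam =
     permutations_of_multiset (\<Sum>i = 1..length lam. replicate_mset (lam ! (i - 1)) i)"

text \<open>Descent positions are counted from \<open>1\<close>, whereas list indices start at \<open>0\<close>.\<close>

definition Des :: "nat list \<Rightarrow> nat set" where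
  "Des w = {i. 1 \<le> i \<and> i < length w \<and> w ! (i - 1) > w ! i}"

definition des :: "nat list \<Rightarrow> nat" where
  "des w = card (Des w)"

definition maj :: "nat list \<Rightarrow> nat" where
  "maj w = \<Sum> (Des w)"

text \<open>
  The integer polynomial \<open>C\<^sub>\<lambda>(x, q)\<close>, given by its values in an arbitrary commutative ring.
\<close>

definition C_poly :: "nat list \<Rightarrow> 'r \<Rightarrow> 'r \<Rightarrow> 'r :: comm_ring_1" where
  "C_poly lam x q = (\<Sum>w\<in>multiset_words lam. x ^ des w * q ^ maj w)"

text \<open>
  The product of \<open>F p\<close> over the primes \<open>p\<close> in increasing order converges to \<open>L\<close>, in the sense of
  \<open>has_prod\<close>: finitely many factors may vanish, and the product of the remaining ones converges to
  a nonzero limit.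
\<close>

definition has_prime_prod :: "(nat \<Rightarrow> complex) \<Rightarrow> complex \<Rightarrow> bool" where
  "has_prime_prod F L \<longleftrightarrow> (\<lambda>p. if prime p then F p else 1) has_prod L"

end

theory Submission
  imports Defs
begin

text \<open>
  Let \<open>F(n)\<close> be the number of points that the \<open>n\<close>-th iterate of a map fixes, and \<open>O(n)\<close> the number
  of its closed orbits of length \<open>n\<close>. Sorting the periodic points by their orbits gives
  \<open>F(n) = \<Sum> d O(d)\<close>, summed over the divisors \<open>d\<close> of \<open>n\<close> (\<open>card_periodic_points\<close>). For \<open>T\<^sub>r\<close> this
  is \<open>\<Sum> d a\<^sub>d(\<int>\<^sup>r)\<close>, which is the recursion that computes \<open>a\<^sub>n\<close> of the lattice of rank \<open>r + 1\<close>
  (\<open>subgroup_count_Suc\<close>): a subgroup of \<open>\<int>\<^sup>r \<times> \<int>\<close> of index \<open>n\<close> consists of a subgroup \<open>K\<close> of \<open>\<int>\<^sup>r\<close>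
  whose index \<open>d\<close> divides \<open>n\<close> and one of the \<open>d\<close> cosets of \<open>K\<close>. Periodic points, unlike orbits,
  behave well under Cartesian products (\<open>periodic_points_product\<close>), so for \<open>T\<^sub>\<lambda>\<close> the number \<open>F(n)\<close>
  is the product over the parts \<open>l\<close> of \<open>\<lambda>\<close> of the numbers of subgroups of index \<open>n\<close> in the lattice
  of rank \<open>l + 1\<close>.

  This \<open>F\<close> is multiplicative in \<open>n\<close>; therefore so is \<open>n O(n)\<close>, which has \<open>F\<close> as its divisor sums
  (\<open>multiplicative_of_sum_divisors_multiplicative\<close>). The bound of \<open>subgroup_count_le_power\<close> makes
  the orbit Dirichlet series absolutely convergent for \<open>Re s > N\<close>, and such a series with
  multiplicative coefficients is the product over all primes \<open>p\<close> of its restrictions to the powers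
  of \<open>p\<close> (\<open>euler_product_multiplicative\<close>).

  The number of subgroups of index \<open>p\<^sup>k\<close> in the lattice of rank \<open>l + 1\<close> is the Gaussian binomial
  coefficient of \<open>l + k\<close> over \<open>k\<close> at \<open>q = p\<close> (\<open>of_nat_subgroup_count_prime_power\<close>). With \<open>x = p\<close>
  to the power \<open>- 1 - s\<close>, the Euler factor is \<open>1 - x\<close> times the generating function in \<open>x\<close> of the
  products of these coefficients over the parts of \<open>\<lambda>\<close>. MacMahon's identity
  (\<open>prod_gauss_binom_generating_function\<close>) evaluates the generating function as \<open>C\<^sub>\<lambda>(x, p)\<close>
  divided by the product of \<open>1 - x p\<^sup>i\<close> for \<open>i = 0, \<dots>, N\<close>, and \<open>1 - x\<close> cancels.

  For MacMahon's identity, fix a word \<open>w\<close> and a bound \<open>k\<close>, and consider the weakly decreasing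
  sequences of numbers up to \<open>k\<close>, of the length of \<open>w\<close>, that decrease strictly at the descents of
  \<open>w\<close>, weighted by \<open>q\<close> to the power of their sum. A pair of a word and such a sequence is a sorted
  list of pairs of a number and a letter, that is, an independent choice, for each letter, of a
  multiset of numbers up to \<open>k\<close>; so the sum over all \<open>w\<close> is a product of Gaussian binomial
  coefficients (\<open>sum_block_sum_eq_prod_gauss_binom\<close>). For a fixed \<open>w\<close>, on the other hand, the
  generating function in \<open>k\<close> is found by removing the letters from the right
  (\<open>block_sum_generating_function\<close>).
\<close>

section \<open>Periodic points and closed orbits\<close>

definition periodic_points :: "'a set \<Rightarrow> ('a \<Rightarrow> 'a) \<Rightarrow> nat \<Rightarrow> 'a set" where
  "periodic_points X T n = {x \<in> X. (T ^^ n) x = x}"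

definition forward_orbit :: "('a \<Rightarrow> 'a) \<Rightarrow> 'a \<Rightarrow> 'a set" where
  "forward_orbit T x = range (\<lambda>k. (T ^^ k) x)"

lemma funpow_funpow: "(T ^^ m) ((T ^^ n) x) = (T ^^ (m + n)) x"
  by (simp add: funpow_add)

lemma funpow_fixed_dvd:
  assumes "(T ^^ d) x = x" "d dvd n"
  shows "(T ^^ n) x = x"
  using funpow_mod_eq[OF assms(1), of n] assms(2) by simp

lemma funpow_in_space:
  assumes "T \<in> X \<rightarrow> X" "x \<in> X"
  shows "(T ^^ k) x \<in> X"
  using assms by (induction k) auto

lemma forward_orbit_eq_image:
  assumes "(T ^^ n) x = x" "n \<ge> 1"
  shows "forward_orbit T x = (\<lambda>k. (T ^^ k) x) ` {..<n}"
proof -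
  have "(T ^^ k) x \<in> (\<lambda>k. (T ^^ k) x) ` {..<n}" for k
  proof (rule image_eqI)
    show "(T ^^ k) x = (T ^^ (k mod n)) x" using funpow_mod_eq[OF assms(1)] by simp
    show "k mod n \<in> {..<n}" using assms(2) by simp
  qed
  then show ?thesis unfolding forward_orbit_def by blast
qed

lemma forward_orbit_eq_image_atLeastAtMost:
  assumes "(T ^^ n) x = x" "n \<ge> 1"
  shows "forward_orbit T x = (\<lambda>k. (T ^^ k) x) ` {0..n}"
proof
  show "forward_orbit T x \<subseteq> (\<lambda>k. (T ^^ k) x) ` {0..n}"
    unfolding forward_orbit_eq_image[OF assms] by (intro image_mono) auto
qed (auto simp: forward_orbit_def)

lemma closed_orbits_altdef:
  assumes "n \<ge> 1"
  shows "closed_orbits X T n =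
    {forward_orbit T x |x. x \<in> periodic_points X T n \<and> card (forward_orbit T x) = n}"
proof -
  have "(x \<in> X \<and> A = (\<lambda>k. (T ^^ k) x) ` {0..n} \<and> (T ^^ n) x = x \<and> card A = n) \<longleftrightarrow>
      (A = forward_orbit T x \<and> x \<in> periodic_points X T n \<and> card (forward_orbit T x) = n)" for x A
    using forward_orbit_eq_image_atLeastAtMost[OF _ assms, of T x]
    by (cases "(T ^^ n) x = x") (auto simp: periodic_points_def)
  then show ?thesis unfolding closed_orbits_def Bex_def by simp
qed

lemma forward_orbit_eq:
  assumes "(T ^^ n) x = x" "n \<ge> 1" "y \<in> forward_orbit T x"
  shows "forward_orbit T y = forward_orbit T x"
proof
  have sub: "forward_orbit T b \<subseteq> forward_orbit T a" if "b \<in> forward_orbit T a" for a b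
    using that by (auto simp: forward_orbit_def funpow_funpow)
  show "forward_orbit T y \<subseteq> forward_orbit T x" using assms(3) by (rule sub)
  from assms(3) obtain k where k: "y = (T ^^ k) x" by (auto simp: forward_orbit_def)
  have "(T ^^ (n * k - k)) y = (T ^^ (n * k)) x"
    using assms(2) unfolding k funpow_funpow by simp
  also have "\<dots> = x" using assms(1) by (rule funpow_fixed_dvd) simp
  finally have "x \<in> forward_orbit T y" unfolding forward_orbit_def by (metis rangeI)
  then show "forward_orbit T x \<subseteq> forward_orbit T y" by (rule sub)
qed

text \<open>
  The length of the orbit is the least period. The least period divides every period, and the
  points before it are distinct because a repetition would give a smaller period.
\<close>

lemma card_forward_orbit:
  assumes "(T ^^ n) x = x" "n \<ge> 1"
  shows "card (forward_orbit T x) dvd n" "(T ^^ card (forward_orbit T x)) x = x"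
    "card (forward_orbit T x) \<ge> 1"
proof -
  define d where "d = (LEAST d. d \<ge> 1 \<and> (T ^^ d) x = x)"
  have "d \<ge> 1 \<and> (T ^^ d) x = x" unfolding d_def by (rule LeastI[of _ n]) (use assms in simp)
  then have d: "d \<ge> 1" "(T ^^ d) x = x" by auto
  have min: "k = 0" if "(T ^^ k) x = x" "k < d" for k
    using not_less_Least[of k "\<lambda>d. d \<ge> 1 \<and> (T ^^ d) x = x"] that unfolding d_def by auto
  have "n mod d = 0"
    using min[of "n mod d"] funpow_mod_eq[OF d(2), of n] assms(1) d(1) by simp
  have "i = j" if "i \<le> j" "j < d" "(T ^^ i) x = (T ^^ j) x" for i j
  proof -
    have "(T ^^ (d - j + i)) x = (T ^^ (d - j)) ((T ^^ j) x)"
      using that(3) by (simp add: funpow_add)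
    also have "\<dots> = (T ^^ (d - j + j)) x" by (simp only: funpow_add o_apply)
    also have "\<dots> = x" using that d by simp
    finally have per: "(T ^^ (d - j + i)) x = x" .
    show ?thesis
    proof (rule ccontr)
      assume "i \<noteq> j"
      then have "d - j + i < d" using that(1,2) by linarith
      then have "d - j + i = 0" by (rule min[OF per])
      then show False using that(2) by linarith
    qed
  qed
  then have "inj_on (\<lambda>k. (T ^^ k) x) {..<d}"
    by (intro inj_onI) (metis lessThan_iff nat_le_linear)
  then have "card (forward_orbit T x) = d"
    unfolding forward_orbit_eq_image[OF d(2,1)] by (simp add: card_image)
  then show "card (forward_orbit T x) dvd n" "(T ^^ card (forward_orbit T x)) x = x"
    "card (forward_orbit T x) \<ge> 1"
    using d \<open>n mod d = 0\<close> by auto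
qed

text \<open>
  A point has period \<open>n\<close> exactly if its least period divides \<open>n\<close>, so the periodic points are
  partitioned by the closed orbits whose lengths divide \<open>n\<close>.
\<close>

lemma periodic_points_eq_Union_closed_orbits:
  assumes T: "T \<in> X \<rightarrow> X" and n: "n \<ge> 1"
  shows "periodic_points X T n = \<Union> (\<Union>d\<in>{d. d dvd n}. closed_orbits X T d)"
proof (intro equalityI subsetI)
  fix x assume "x \<in> periodic_points X T n"
  then have x: "x \<in> X" "(T ^^ n) x = x" by (auto simp: periodic_points_def)
  let ?d = "card (forward_orbit T x)"
  note d = card_forward_orbit[OF x(2) n]
  have "forward_orbit T x \<in> closed_orbits X T ?d"
    unfolding closed_orbits_altdef[OF d(3)] using x d by (auto simp: periodic_points_def)
  moreover have "x \<in> forward_orbit T x" unfolding forward_orbit_def by (rule range_eqI[of _ _ 0]) simp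
  ultimately show "x \<in> \<Union> (\<Union>d\<in>{d. d dvd n}. closed_orbits X T d)" using d(1) by blast
next
  fix y assume "y \<in> \<Union> (\<Union>d\<in>{d. d dvd n}. closed_orbits X T d)"
  then obtain d A where d: "d dvd n" "A \<in> closed_orbits X T d" "y \<in> A" by blast
  then have "d \<ge> 1" using n by (metis dvd_0_left less_one not_le)
  then obtain x where x: "x \<in> X" "(T ^^ d) x = x" "y \<in> forward_orbit T x"
    using d(2,3) unfolding closed_orbits_altdef[OF \<open>d \<ge> 1\<close>] periodic_points_def by blast
  then obtain k where k: "y = (T ^^ k) x" by (auto simp: forward_orbit_def)
  have "(T ^^ n) y = (T ^^ k) ((T ^^ n) x)"
    unfolding k funpow_funpow by (simp only: add.commute)
  also have "(T ^^ n) x = x" using funpow_fixed_dvd x(2) d(1) .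
  finally show "y \<in> periodic_points X T n"
    using k funpow_in_space[OF T x(1)] by (simp add: periodic_points_def)
qed

lemma closed_orbits_disjoint:
  assumes "d \<ge> 1" "e \<ge> 1" "A \<in> closed_orbits X T d" "B \<in> closed_orbits X T e" "A \<inter> B \<noteq> {}"
  shows "A = B"
proof -
  obtain x where x: "A = forward_orbit T x" "(T ^^ d) x = x"
    using assms closed_orbits_altdef[of d X T] by (auto simp: periodic_points_def)
  obtain y where y: "B = forward_orbit T y" "(T ^^ e) y = y"
    using assms closed_orbits_altdef[of e X T] by (auto simp: periodic_points_def)
  obtain z where "z \<in> A" "z \<in> B" using assms by blast
  then show ?thesis
    using forward_orbit_eq[OF x(2) assms(1)] forward_orbit_eq[OF y(2) assms(2)] x y by metis
qed

text \<open>
  Counting the partition into orbits. This relation is used in both directions: it gives the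
  periodic points of each factor from its orbits, and it determines the orbits of the product from
  the periodic points of the product.
\<close>

lemma card_periodic_points:
  assumes T: "T \<in> X \<rightarrow> X" and n: "n \<ge> 1"
    and fin: "\<And>d. d \<ge> 1 \<Longrightarrow> finite (closed_orbits X T d)"
  shows "finite (periodic_points X T n)"
    and "card (periodic_points X T n) = (\<Sum>d | d dvd n. d * orbit_count X T d)"
proof -
  have d1: "d \<ge> 1" if "d dvd n" for d using that n by (metis dvd_0_left less_one not_le)
  have finD: "finite {d. d dvd n}" using n by (simp add: finite_divisors_nat)
  have cardA: "card A = d" if "A \<in> closed_orbits X T d" for A d
    using that by (auto simp: closed_orbits_def)
  have finA: "finite A" if "A \<in> closed_orbits X T d" "d dvd n" for A d
    using cardA[OF that(1)] d1[OF that(2)] by (intro card_ge_0_finite) simp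
  show "finite (periodic_points X T n)"
    unfolding periodic_points_eq_Union_closed_orbits[OF T n]
    using finD finA fin d1 by (intro finite_Union) auto
  have "card (periodic_points X T n) = (\<Sum>A\<in>(\<Union>d\<in>{d. d dvd n}. closed_orbits X T d). card A)"
    unfolding periodic_points_eq_Union_closed_orbits[OF T n]
  proof (rule card_Union_disjoint)
    show "pairwise disjnt (\<Union>d\<in>{d. d dvd n}. closed_orbits X T d)"
    proof (rule pairwiseI)
      fix A B assume AB: "A \<in> (\<Union>d\<in>{d. d dvd n}. closed_orbits X T d)"
        "B \<in> (\<Union>d\<in>{d. d dvd n}. closed_orbits X T d)" "A \<noteq> B"
      then obtain d e where "d dvd n" "e dvd n" "A \<in> closed_orbits X T d" "B \<in> closed_orbits X T e"
        by blast
      then show "disjnt A B"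
        using closed_orbits_disjoint[of d e A X T B] d1 AB(3) unfolding disjnt_def by blast
    qed
  qed (use finA in auto)
  also have "\<dots> = (\<Sum>d | d dvd n. \<Sum>A\<in>closed_orbits X T d. card A)"
    using finD fin d1 by (intro sum.UNION_disjoint) (auto dest!: cardA)
  also have "\<dots> = (\<Sum>d | d dvd n. d * orbit_count X T d)"
    by (intro sum.cong refl) (simp add: cardA orbit_count_def)
  finally show "card (periodic_points X T n) = (\<Sum>d | d dvd n. d * orbit_count X T d)" .
qed

lemma finite_closed_orbits_if_finite_periodic_points:
  assumes "T \<in> X \<rightarrow> X" "n \<ge> 1" "finite (periodic_points X T n)"
  shows "finite (closed_orbits X T n)"
proof -
  have "closed_orbits X T n \<subseteq> Pow (periodic_points X T n)"
    unfolding periodic_points_eq_Union_closed_orbits[OF assms(1,2)] using dvd_refl[of n] by blast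
  then show ?thesis using assms(3) finite_subset by auto
qed

lemma product_map_in_product_space:
  assumes "\<And>r. r \<in> set lam \<Longrightarrow> T r \<in> X r \<rightarrow> X r"
  shows "product_map T lam \<in> product_space X lam \<rightarrow> product_space X lam"
proof
  fix x assume x: "x \<in> product_space X lam"
  have "T (lam ! i) (x i) \<in> X (lam ! i)" if "i < length lam" for i
    using assms[OF nth_mem[OF that]] x that by (auto simp: product_space_def)
  then show "product_map T lam x \<in> product_space X lam"
    by (simp add: product_map_def product_space_def)
qed

text \<open>
  This is why periodic points are counted in place of orbits: a product of orbits splits into
  several orbits, but the points of period \<open>n\<close> of a product are the tuples of points of period
  \<open>n\<close>.
\<close>

lemma periodic_points_product:
  "periodic_points (product_space X lam) (product_map T lam) n =
   (\<Pi>\<^sub>E i\<in>{..<length lam}. periodic_points (X (lam ! i)) (T (lam ! i)) n)"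
proof -
  have iter: "(product_map T lam ^^ n) x = (\<lambda>i\<in>{..<length lam}. (T (lam ! i) ^^ n) (x i))"
    if "x \<in> extensional {..<length lam}" for x :: "nat \<Rightarrow> 'a"
    using that
  proof (induction n)
    case (Suc n)
    then have "(product_map T lam ^^ Suc n) x =
        product_map T lam (\<lambda>i\<in>{..<length lam}. (T (lam ! i) ^^ n) (x i))"
      by (simp only: funpow.simps o_apply)
    also have "\<dots> = (\<lambda>i\<in>{..<length lam}. (T (lam ! i) ^^ Suc n) (x i))"
      unfolding product_map_def by (rule restrict_ext) simp
    finally show ?case .
  qed (simp add: extensional_restrict)
  have "x \<in> periodic_points (product_space X lam) (product_map T lam) n \<longleftrightarrow>
      x \<in> (\<Pi>\<^sub>E i\<in>{..<length lam}. periodic_points (X (lam ! i)) (T (lam ! i)) n)" for x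
  proof (cases "x \<in> extensional {..<length lam}")
    case True
    then have "(product_map T lam ^^ n) x = x \<longleftrightarrow> (\<forall>i<length lam. (T (lam ! i) ^^ n) (x i) = x i)"
      unfolding iter[OF True] by (auto simp: fun_eq_iff restrict_def extensional_def)
    then show ?thesis
      using True by (auto simp: periodic_points_def product_space_def PiE_iff)
  qed (auto simp: periodic_points_def product_space_def PiE_iff)
  then show ?thesis by blast
qed

section \<open>Subgroups of finite index in integer lattices\<close>

definition subgroups_of_index :: "('a, 'b) monoid_scheme \<Rightarrow> nat \<Rightarrow> 'a set set" where
  "subgroups_of_index G n = {H. subgroup H G \<and> card (rcosets\<^bsub>G\<^esub> H) = n}"

lemma (in group) rcoset_eq_iff:
  assumes "subgroup H G" "x \<in> carrier G" "y \<in> carrier G"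
  shows "H #> x = H #> y \<longleftrightarrow> x \<otimes> inv y \<in> H"
proof -
  have "H #> x = H #> y \<longleftrightarrow> x \<in> H #> y"
    using repr_independence repr_independenceD assms by metis
  then show ?thesis
    using subgroup.rcos_module[OF assms(1) group_axioms assms(3,2)] by simp
qed

lemma card_image_eq_if_same_fibres:
  assumes "\<And>x y. x \<in> A \<Longrightarrow> y \<in> A \<Longrightarrow> f x = f y \<longleftrightarrow> g x = g y"
  shows "card (f ` A) = card (g ` A)"
proof -
  let ?h = "\<lambda>b. f (inv_into A g b)"
  have inv: "inv_into A g b \<in> A" "g (inv_into A g b) = b" if "b \<in> g ` A" for b
    using that by (auto intro: inv_into_into f_inv_into_f)
  have "inj_on ?h (g ` A)"
    using assms inv by (intro inj_onI) metis
  moreover have "?h (g x) = f x" if "x \<in> A" for x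
    using assms inv that by (metis imageI)
  then have "?h ` g ` A = f ` A" by (simp add: image_image)
  ultimately show ?thesis by (metis card_image)
qed

text \<open>
  Indices are computed with this rule: any function that separates the cosets takes as many values
  as there are cosets.
\<close>

lemma (in group) card_rcosets_eq_card_image:
  assumes "subgroup H G"
    and "\<And>x y. x \<in> carrier G \<Longrightarrow> y \<in> carrier G \<Longrightarrow> f x = f y \<longleftrightarrow> x \<otimes> inv y \<in> H"
  shows "card (rcosets H) = card (f ` carrier G)"
proof -
  have "rcosets H = (\<lambda>x. H #> x) ` carrier G" by (auto simp: RCOSETS_def)
  then show ?thesis
    using card_image_eq_if_same_fibres[of "carrier G" f "\<lambda>x. H #> x"] assms by (simp add: rcoset_eq_iff)
qed

text \<open>
  The coset of the preimage is a complete invariant of the cosets of \<open>f ` H\<close>, so the index is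
  preserved.
\<close>

lemma iso_image_subgroups_of_index:
  assumes "group G" "group G'" "f \<in> iso G G'"
  shows "H \<in> subgroups_of_index G n \<Longrightarrow> f ` H \<in> subgroups_of_index G' n"
proof -
  interpret G: group G by fact
  interpret G': group G' by fact
  interpret f: group_hom G G' f
    using assms by (simp add: group_hom_def group_hom_axioms_def iso_def)
  have bij: "bij_betw f (carrier G) (carrier G')" using assms by (simp add: iso_def)
  assume "H \<in> subgroups_of_index G n"
  then have H: "subgroup H G" "card (rcosets\<^bsub>G\<^esub> H) = n"
    by (auto simp: subgroups_of_index_def)
  have fH: "subgroup (f ` H) G'" using H by (simp add: f.subgroup_img_is_subgroup)
  let ?\<phi> = "\<lambda>y. H #>\<^bsub>G\<^esub> inv_into (carrier G) f y"
  have "?\<phi> ` carrier G' = (\<lambda>x. H #>\<^bsub>G\<^esub> x) ` carrier G"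
    using bij_betw_imp_surj_on[OF bij_betw_inv_into[OF bij]] by (metis image_image)
  then have img: "?\<phi> ` carrier G' = rcosets\<^bsub>G\<^esub> H" by (auto simp: RCOSETS_def)
  have "card (rcosets\<^bsub>G'\<^esub> (f ` H)) = card (?\<phi> ` carrier G')"
  proof (rule G'.card_rcosets_eq_card_image[OF fH])
    fix x' y' assume "x' \<in> carrier G'" "y' \<in> carrier G'"
    then obtain x y where xy: "x \<in> carrier G" "y \<in> carrier G" "x' = f x" "y' = f y"
      using bij by (metis bij_betw_def image_iff)
    have "x' \<otimes>\<^bsub>G'\<^esub> inv\<^bsub>G'\<^esub> y' = f (x \<otimes>\<^bsub>G\<^esub> inv\<^bsub>G\<^esub> y)" using xy by simp
    moreover have "f (x \<otimes>\<^bsub>G\<^esub> inv\<^bsub>G\<^esub> y) \<in> f ` H \<longleftrightarrow> x \<otimes>\<^bsub>G\<^esub> inv\<^bsub>G\<^esub> y \<in> H"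
      using bij xy subgroup.subset[OF H(1)] by (intro inj_on_image_mem_iff) (auto simp: bij_betw_def)
    moreover have "inv_into (carrier G) f x' = x" "inv_into (carrier G) f y' = y"
      using xy bij by (simp_all add: bij_betw_def)
    ultimately show "?\<phi> x' = ?\<phi> y' \<longleftrightarrow> x' \<otimes>\<^bsub>G'\<^esub> inv\<^bsub>G'\<^esub> y' \<in> f ` H"
      using xy G.rcoset_eq_iff[OF H(1)] by simp
  qed
  then show ?thesis using fH H img by (simp add: subgroups_of_index_def)
qed

lemma iso_bij_betw_subgroups_of_index:
  assumes "group G" "group G'" "f \<in> iso G G'"
  shows "bij_betw ((`) f) (subgroups_of_index G n) (subgroups_of_index G' n)"
proof (rule bij_betw_byWitness)
  let ?g = "inv_into (carrier G) f"
  have bij: "bij_betw f (carrier G) (carrier G')" using assms by (simp add: iso_def)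
  have sub: "H \<subseteq> carrier K" if "H \<in> subgroups_of_index K n" for H and K :: "('z, 'w) monoid_scheme"
    using that by (auto simp: subgroups_of_index_def dest: subgroup.subset)
  have g: "?g \<in> iso G' G" using assms group.iso_set_sym by blast
  show "\<forall>H\<in>subgroups_of_index G n. ?g ` f ` H = H"
    using bij sub by (metis bij_betw_imp_inj_on inv_into_image_cancel)
  show "\<forall>H\<in>subgroups_of_index G' n. f ` ?g ` H = H"
    using bij sub by (metis bij_betw_imp_surj_on image_inv_into_cancel)
  show "(`) f ` subgroups_of_index G n \<subseteq> subgroups_of_index G' n"
    using iso_image_subgroups_of_index[OF assms] by blast
  show "(`) ?g ` subgroups_of_index G' n \<subseteq> subgroups_of_index G n"
    using iso_image_subgroups_of_index[OF assms(2,1) g] by blast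
qed

text \<open>
  For a subgroup \<open>K\<close> of a commutative group \<open>G\<close> and \<open>c > 0\<close>, this is the subgroup of \<open>G \<times> \<int>\<close>
  generated by \<open>K \<times> {0}\<close> and \<open>(v, c)\<close>, whose elements are the pairs \<open>(k v\<^sup>t, c t)\<close> with \<open>k \<in> K\<close>.
\<close>

definition extended_subgroup ::
  "('a, 'b) monoid_scheme \<Rightarrow> nat \<Rightarrow> 'a set \<Rightarrow> 'a \<Rightarrow> ('a \<times> int) set" where
  "extended_subgroup G c K v =
     {(g, z). g \<in> carrier G \<and> int c dvd z \<and> g \<otimes>\<^bsub>G\<^esub> v [^]\<^bsub>G\<^esub> (- (z div int c)) \<in> K}"

context comm_group
begin

interpretation P: group "G \<times>\<times> integer_group"
  by (simp add: DirProd_group is_group)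

lemma mem_extended_subgroup_iff:
  assumes "c > 0"
  shows "(g, int c * t) \<in> extended_subgroup G c K v \<longleftrightarrow> g \<in> carrier G \<and> g \<otimes> v [^] (- t) \<in> K"
  using assms by (simp add: extended_subgroup_def)

lemma extended_subgroupE:
  assumes "x \<in> extended_subgroup G c K v"
  obtains g t where "x = (g, int c * t)" "g \<in> carrier G" "g \<otimes> v [^] (- t) \<in> K"
proof -
  from assms obtain g z where x: "x = (g, z)" "g \<in> carrier G" "int c dvd z" "g \<otimes> v [^] (- (z div int c)) \<in> K"
    by (auto simp: extended_subgroup_def)
  then have "z = int c * (z div int c)" by simp
  then show ?thesis using x that by metis
qed

lemma subgroup_extended_subgroup:
  assumes K: "subgroup K G" and v: "v \<in> carrier G" and c: "c > 0"
  shows "subgroup (extended_subgroup G c K v) (G \<times>\<times> integer_group)"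
proof -
  interpret K: subgroup K G by fact
  show ?thesis
  proof (rule P.subgroupI)
    show "extended_subgroup G c K v \<subseteq> carrier (G \<times>\<times> integer_group)"
      by (auto simp: extended_subgroup_def)
    have "(\<one>, int c * 0) \<in> extended_subgroup G c K v"
      unfolding mem_extended_subgroup_iff[OF c] using v by simp
    then show "extended_subgroup G c K v \<noteq> {}" by blast
  next
    fix x assume "x \<in> extended_subgroup G c K v"
    then obtain g t where x: "x = (g, int c * t)" "g \<in> carrier G" "g \<otimes> v [^] (- t) \<in> K"
      by (rule extended_subgroupE)
    have "inv g \<otimes> v [^] (- (- t)) = inv (g \<otimes> v [^] (- t))"
      using x v by (simp add: inv_mult int_pow_neg)
    then have "(inv g, int c * (- t)) \<in> extended_subgroup G c K v"
      unfolding mem_extended_subgroup_iff[OF c] using x by simp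
    then show "inv\<^bsub>G \<times>\<times> integer_group\<^esub> x \<in> extended_subgroup G c K v"
      using x by (simp add: is_group)
  next
    fix x y assume "x \<in> extended_subgroup G c K v" "y \<in> extended_subgroup G c K v"
    then obtain g t h u where x: "x = (g, int c * t)" "g \<in> carrier G" "g \<otimes> v [^] (- t) \<in> K"
      and y: "y = (h, int c * u)" "h \<in> carrier G" "h \<otimes> v [^] (- u) \<in> K"
      by (elim extended_subgroupE)
    have "- (t + u) = - t + - u" by simp
    then have "(g \<otimes> h) \<otimes> v [^] (- (t + u)) = (g \<otimes> h) \<otimes> (v [^] (- t) \<otimes> v [^] (- u))"
      using int_pow_mult[OF v] by metis
    also have "\<dots> = (g \<otimes> v [^] (- t)) \<otimes> (h \<otimes> v [^] (- u))"
      using x y v by (simp add: m_ac)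
    finally have "(g \<otimes> h) \<otimes> v [^] (- (t + u)) \<in> K" using x y by simp
    then have "(g \<otimes> h, int c * (t + u)) \<in> extended_subgroup G c K v"
      unfolding mem_extended_subgroup_iff[OF c] using x y by simp
    then show "x \<otimes>\<^bsub>G \<times>\<times> integer_group\<^esub> y \<in> extended_subgroup G c K v"
      using x y by (simp add: distrib_left)
  qed
qed

text \<open>
  Subtracting a multiple of \<open>(v, c)\<close> moves the second coordinate of an element into \<open>{0..<c}\<close>; the
  reduced second coordinate and the coset of the first one modulo \<open>K\<close> then form a complete
  invariant, with \<open>c\<close> times the index of \<open>K\<close> possible values.
\<close>

lemma card_rcosets_extended_subgroup:
  assumes K: "subgroup K G" and v: "v \<in> carrier G" and c: "c > 0"
  shows "card (rcosets\<^bsub>G \<times>\<times> integer_group\<^esub> extended_subgroup G c K v) = c * card (rcosets K)"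
proof -
  interpret K: subgroup K G by fact
  let ?\<phi> = "\<lambda>(g, z). (z mod int c, K #> (g \<otimes> v [^] (- (z div int c))))"
  have "card (rcosets\<^bsub>G \<times>\<times> integer_group\<^esub> extended_subgroup G c K v)
      = card (?\<phi> ` carrier (G \<times>\<times> integer_group))"
  proof (rule P.card_rcosets_eq_card_image[OF subgroup_extended_subgroup[OF assms]])
    fix x y assume "x \<in> carrier (G \<times>\<times> integer_group)" "y \<in> carrier (G \<times>\<times> integer_group)"
    then obtain g z h u where x: "x = (g, z)" "g \<in> carrier G" and y: "y = (h, u)" "h \<in> carrier G"
      by auto
    have diff: "x \<otimes>\<^bsub>G \<times>\<times> integer_group\<^esub> inv\<^bsub>G \<times>\<times> integer_group\<^esub> y = (g \<otimes> inv h, z - u)"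
      using x y by (simp add: is_group)
    show "?\<phi> x = ?\<phi> y \<longleftrightarrow> x \<otimes>\<^bsub>G \<times>\<times> integer_group\<^esub> inv\<^bsub>G \<times>\<times> integer_group\<^esub> y \<in> extended_subgroup G c K v"
    proof (cases "z mod int c = u mod int c")
      case False
      then show ?thesis unfolding diff using x y by (auto simp: extended_subgroup_def mod_eq_dvd_iff)
    next
      case True
      then have "int c dvd z - u" by (simp add: mod_eq_dvd_iff)
      then obtain t where zu: "z - u = int c * t" by (elim dvdE)
      then have "z = u + int c * t" by simp
      then have zdiv: "- (z div int c) + u div int c = - t" using c by simp
      have "g \<otimes> v [^] (- (z div int c)) \<otimes> inv (h \<otimes> v [^] (- (u div int c)))
          = g \<otimes> inv h \<otimes> (v [^] (- (z div int c)) \<otimes> v [^] (u div int c))"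
        using x y v by (simp add: inv_mult int_pow_neg m_ac)
      also have "v [^] (- (z div int c)) \<otimes> v [^] (u div int c) = v [^] (- t)"
        using int_pow_mult[OF v, symmetric] by (simp only: zdiv)
      finally have "K #> (g \<otimes> v [^] (- (z div int c))) = K #> (h \<otimes> v [^] (- (u div int c)))
          \<longleftrightarrow> g \<otimes> inv h \<otimes> v [^] (- t) \<in> K"
        using x y v by (simp add: rcoset_eq_iff[OF K])
      then show ?thesis
        unfolding diff zu mem_extended_subgroup_iff[OF c] using x y True by simp
    qed
  qed
  also have "?\<phi> ` carrier (G \<times>\<times> integer_group) = {0..<int c} \<times> rcosets K"
  proof (intro equalityI subsetI)
    fix y assume "y \<in> ?\<phi> ` carrier (G \<times>\<times> integer_group)"
    then show "y \<in> {0..<int c} \<times> rcosets K"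
      using c v by (auto intro!: rcosetsI K.subset)
  next
    fix y assume "y \<in> {0..<int c} \<times> rcosets K"
    then obtain j g where y: "y = (j, K #> g)" "g \<in> carrier G" "0 \<le> j" "j < int c"
      by (auto simp: RCOSETS_def)
    have "(g, j) \<in> carrier (G \<times>\<times> integer_group)" using y by simp
    moreover have "y = ?\<phi> (g, j)" using y v by simp
    ultimately show "y \<in> ?\<phi> ` carrier (G \<times>\<times> integer_group)" by (rule rev_image_eqI)
  qed
  finally show ?thesis by (simp add: card_cartesian_product)
qed

text \<open>
  The two slices recover \<open>K\<close> and the coset of \<open>v\<close>, so different data give different subgroups.
\<close>

lemma extended_subgroup_slices:
  assumes K: "subgroup K G" and v: "v \<in> carrier G" and c: "c > 0"
  shows "{g. (g, 0) \<in> extended_subgroup G c K v} = K"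
    and "{g. (g, int c) \<in> extended_subgroup G c K v} = K #> v"
proof -
  interpret K: subgroup K G by fact
  show "{g. (g, 0) \<in> extended_subgroup G c K v} = K"
    using v K.mem_carrier by (auto simp: extended_subgroup_def)
  have "g \<in> K #> v \<longleftrightarrow> g \<in> carrier G \<and> g \<otimes> inv v \<in> K" for g
    using K.rcos_module[OF is_group v] K.elemrcos_carrier[OF is_group v] by blast
  then show "{g. (g, int c) \<in> extended_subgroup G c K v} = K #> v"
    using v c by (auto simp: extended_subgroup_def int_pow_neg)
qed

lemma subgroup_DirProd_integer_multiple:
  assumes H: "subgroup H (G \<times>\<times> integer_group)" and v: "(v, c) \<in> H"
  shows "(v [^] (t::int), c * t) \<in> H"
proof -
  interpret H: subgroup H "G \<times>\<times> integer_group" by fact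
  have vG: "v \<in> carrier G" using H.subset v by auto
  show ?thesis
  proof (induction t rule: int_induct[of _ 0])
    case base
    then show ?case using H.one_closed by simp
  next
    case (step1 t)
    then have "(v [^] t, c * t) \<otimes>\<^bsub>G \<times>\<times> integer_group\<^esub> (v, c) \<in> H"
      using v by (intro H.m_closed)
    then show ?case using vG by (simp add: int_pow_mult distrib_left)
  next
    case (step2 t)
    then have "(v [^] t, c * t) \<otimes>\<^bsub>G \<times>\<times> integer_group\<^esub> inv\<^bsub>G \<times>\<times> integer_group\<^esub> (v, c) \<in> H"
      using v by (intro H.m_closed H.m_inv_closed)
    then show ?case using vG by (simp add: int_pow_diff right_diff_distrib is_group)
  qed
qed

text \<open>
  Subtracting the right multiple of \<open>(v, c)\<close> moves an element into the slice of \<open>H\<close> at \<open>0\<close>.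
\<close>

lemma subgroup_DirProd_integer_eq_extended_subgroup:
  assumes H: "subgroup H (G \<times>\<times> integer_group)" and c: "c > 0" and v: "(v, int c) \<in> H"
    and dvd: "\<And>g z. (g, z) \<in> H \<Longrightarrow> int c dvd z"
  shows "H = extended_subgroup G c {g. (g, 0) \<in> H} v"
proof -
  interpret H: subgroup H "G \<times>\<times> integer_group" by fact
  have vG: "v \<in> carrier G" using H.subset v by auto
  have shift: "(g \<otimes> v [^] (- t), 0) \<in> H \<longleftrightarrow> (g, int c * t) \<in> H" if g: "g \<in> carrier G" for g t
  proof
    assume "(g, int c * t) \<in> H"
    then have "(g, int c * t) \<otimes>\<^bsub>G \<times>\<times> integer_group\<^esub> (v [^] (- t), int c * (- t)) \<in> H"
      by (intro H.m_closed subgroup_DirProd_integer_multiple[OF H v])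
    then show "(g \<otimes> v [^] (- t), 0) \<in> H" by simp
  next
    assume "(g \<otimes> v [^] (- t), 0) \<in> H"
    then have "(g \<otimes> v [^] (- t), 0) \<otimes>\<^bsub>G \<times>\<times> integer_group\<^esub> (v [^] t, int c * t) \<in> H"
      by (intro H.m_closed subgroup_DirProd_integer_multiple[OF H v])
    then show "(g, int c * t) \<in> H"
      using g vG by (simp add: m_assoc int_pow_mult[symmetric])
  qed
  show ?thesis
  proof (intro equalityI subsetI)
    fix x assume "x \<in> H"
    moreover obtain g z where "x = (g, z)" by (cases x)
    moreover obtain t where "z = int c * t" using dvd calculation by (meson dvdE)
    ultimately have "x = (g, int c * t)" "g \<in> carrier G" using H.subset by auto
    then show "x \<in> extended_subgroup G c {g. (g, 0) \<in> H} v"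
      using shift \<open>x \<in> H\<close> by (simp add: mem_extended_subgroup_iff[OF c])
  next
    fix x assume "x \<in> extended_subgroup G c {g. (g, 0) \<in> H} v"
    then obtain g t where "x = (g, int c * t)" "g \<in> carrier G" "g \<otimes> v [^] (- t) \<in> {g. (g, 0) \<in> H}"
      by (rule extended_subgroupE)
    then show "x \<in> H" using shift by simp
  qed
qed

text \<open>
  The second coordinates of \<open>H\<close> form a subgroup of \<open>\<int>\<close>. If it were trivial, the elements \<open>(1, z)\<close>
  would lie in infinitely many different cosets; hence it is generated by its least positive
  element \<open>c\<close>.
\<close>

lemma subgroup_DirProd_integer_finite_index:
  assumes H: "subgroup H (G \<times>\<times> integer_group)"
    and fin: "card (rcosets\<^bsub>G \<times>\<times> integer_group\<^esub> H) \<noteq> 0"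
  obtains c v where "c > 0" "(v, int c) \<in> H" "\<And>g z. (g, z) \<in> H \<Longrightarrow> int c dvd z"
proof -
  interpret H: subgroup H "G \<times>\<times> integer_group" by fact
  have "\<exists>g z. (g, z) \<in> H \<and> z \<noteq> 0"
  proof (rule ccontr)
    assume zero: "\<not> ?thesis"
    have "inj (\<lambda>z. H #>\<^bsub>G \<times>\<times> integer_group\<^esub> (\<one>, z :: int))"
    proof (rule injI)
      fix y z :: int
      assume "H #>\<^bsub>G \<times>\<times> integer_group\<^esub> (\<one>, y) = H #>\<^bsub>G \<times>\<times> integer_group\<^esub> (\<one>, z)"
      then have "(\<one>, y - z) \<in> H"
        using P.rcoset_eq_iff[OF H, of "(\<one>, y)" "(\<one>, z)"] by (simp add: is_group)
      then have "y - z = 0" using zero by blast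
      then show "y = z" by simp
    qed
    then have "infinite (range (\<lambda>z. H #>\<^bsub>G \<times>\<times> integer_group\<^esub> (\<one>, z :: int)))"
      using finite_imageD infinite_UNIV_int by blast
    moreover have "range (\<lambda>z. H #>\<^bsub>G \<times>\<times> integer_group\<^esub> (\<one>, z :: int)) \<subseteq> rcosets\<^bsub>G \<times>\<times> integer_group\<^esub> H"
      by (auto intro!: P.rcosetsI H.subset)
    ultimately have "infinite (rcosets\<^bsub>G \<times>\<times> integer_group\<^esub> H)" using finite_subset by blast
    then show False using fin by simp
  qed
  then obtain g z where gz: "(g, z) \<in> H" "z \<noteq> 0" by blast
  define pos where "pos c \<longleftrightarrow> c > 0 \<and> (\<exists>v. (v, int c) \<in> H)" for c
  have "pos (nat \<bar>z\<bar>)"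
  proof -
    have "(g [^] sgn z, z * sgn z) \<in> H" by (rule subgroup_DirProd_integer_multiple[OF H gz(1)])
    moreover have "z * sgn z = int (nat \<bar>z\<bar>)" by (simp flip: abs_sgn)
    ultimately show ?thesis using gz(2) unfolding pos_def by auto
  qed
  define c where "c = (LEAST c. pos c)"
  have "pos c" unfolding c_def by (rule LeastI) fact
  then obtain v where c: "c > 0" and v: "(v, int c) \<in> H" by (auto simp: pos_def)
  have "int c dvd y" if hy: "(h, y) \<in> H" for h y
  proof (rule ccontr)
    assume "\<not> int c dvd y"
    then have r: "y mod int c > 0" using c by (simp add: dvd_eq_mod_eq_0 order.not_eq_order_implies_strict)
    have "(h, y) \<otimes>\<^bsub>G \<times>\<times> integer_group\<^esub> (v [^] (- (y div int c)), int c * (- (y div int c))) \<in> H"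
      by (intro H.m_closed hy subgroup_DirProd_integer_multiple[OF H v])
    moreover have "y + int c * (- (y div int c)) = y mod int c"
      by (simp add: minus_mult_div_eq_mod)
    ultimately have "pos (nat (y mod int c))" using r by (auto simp: pos_def)
    then have "c \<le> nat (y mod int c)" unfolding c_def by (rule Least_le)
    moreover have "y mod int c < int c" using c by simp
    ultimately show False using r by linarith
  qed
  then show ?thesis using c v that by blast
qed

text \<open>
  A subgroup of index \<open>n\<close> of \<open>G \<times> \<int>\<close> is given by its intersection \<open>K\<close> with \<open>G\<close>, whose index \<open>d\<close>
  divides \<open>n\<close>, and by the coset of \<open>K\<close> that lies above the generator \<open>c = n / d\<close> of the projection
  to \<open>\<int>\<close>. There are \<open>d\<close> cosets for each \<open>K\<close>, whence the factor \<open>d\<close>.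
\<close>

lemma subgroups_of_index_DirProd_integer:
  assumes n: "n \<ge> 1" and fin: "\<And>d. d \<ge> 1 \<Longrightarrow> finite (subgroups_of_index G d)"
  shows "finite (subgroups_of_index (G \<times>\<times> integer_group) n)"
    and "card (subgroups_of_index (G \<times>\<times> integer_group) n) =
           (\<Sum>d | d dvd n. d * card (subgroups_of_index G d))"
proof -
  define \<K> where "\<K> = (\<Union>d\<in>{d. d dvd n}. subgroups_of_index G d)"
  \<comment> \<open>The extension depends on the coset only, so any representative serves to construct it.\<close>
  define rep where "rep C = (SOME v. v \<in> C)" for C :: "'a set"
  define ext where
    "ext = (\<lambda>(K, C). extended_subgroup G (n div card (rcosets K)) K (rep C))"
  have d1: "d \<ge> 1" if "d dvd n" for d using that n by (metis dvd_0_left less_one not_le)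
  have in\<K>: "subgroup K G" "card (rcosets K) dvd n" if "K \<in> \<K>" for K
    using that by (auto simp: \<K>_def subgroups_of_index_def)
  have rep: "rep C \<in> carrier G \<and> C = K #> rep C" if K: "subgroup K G" and C: "C \<in> rcosets K" for K C
  proof -
    obtain g where g: "g \<in> carrier G" "C = K #> g" using C unfolding RCOSETS_def by blast
    then have "rep C \<in> C" unfolding rep_def using K rcos_self by (metis someI)
    then show ?thesis
      using g K by (metis repr_independence subgroup.elemrcos_carrier is_group)
  qed
  have quot: "n div card (rcosets K) > 0 \<and> n div card (rcosets K) * card (rcosets K) = n" if "K \<in> \<K>" for K
    using in\<K>[OF that] n d1 by (metis dvd_div_mult_self mult_is_0 neq0_conv not_one_le_zero)
  have slices: "{g. (g, 0) \<in> ext (K, C)} = K" "{g. (g, int (n div card (rcosets K))) \<in> ext (K, C)} = C"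
    if "K \<in> \<K>" "C \<in> rcosets K" for K C
    using extended_subgroup_slices[OF in\<K>(1)[OF that(1)], of "rep C" "n div card (rcosets K)"]
      rep[OF in\<K>(1)[OF that(1)] that(2)] quot[OF that(1)] by (auto simp: ext_def)
  have bij: "bij_betw ext (SIGMA K:\<K>. rcosets K) (subgroups_of_index (G \<times>\<times> integer_group) n)"
  proof (rule bij_betw_imageI)
    show "inj_on ext (SIGMA K:\<K>. rcosets K)"
    proof (rule inj_onI, clarify)
      fix K C K' C'
      assume KC: "K \<in> \<K>" "C \<in> rcosets K" "K' \<in> \<K>" "C' \<in> rcosets K'" "ext (K, C) = ext (K', C')"
      then have "K = K'" using slices(1) by metis
      then show "K = K' \<and> C = C'" using slices(2) KC by metis
    qed
    show "ext ` (SIGMA K:\<K>. rcosets K) = subgroups_of_index (G \<times>\<times> integer_group) n"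
    proof (intro equalityI subsetI)
      fix H assume "H \<in> ext ` (SIGMA K:\<K>. rcosets K)"
      then obtain K C where KC: "K \<in> \<K>" "C \<in> rcosets K" "H = ext (K, C)" by auto
      then show "H \<in> subgroups_of_index (G \<times>\<times> integer_group) n"
        using in\<K>[OF KC(1)] rep[OF _ KC(2)] quot[OF KC(1)]
        by (simp add: ext_def subgroups_of_index_def subgroup_extended_subgroup
            card_rcosets_extended_subgroup)
    next
      fix H assume "H \<in> subgroups_of_index (G \<times>\<times> integer_group) n"
      then have H: "subgroup H (G \<times>\<times> integer_group)" "card (rcosets\<^bsub>G \<times>\<times> integer_group\<^esub> H) = n"
        by (auto simp: subgroups_of_index_def)
      then obtain c v where c: "c > 0" and v: "(v, int c) \<in> H" and dvd: "\<And>g z. (g, z) \<in> H \<Longrightarrow> int c dvd z"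
        using subgroup_DirProd_integer_finite_index[of H] n by (metis not_one_le_zero)
      interpret H: subgroup H "G \<times>\<times> integer_group" by fact
      define K where "K = {g. (g, 0) \<in> H}"
      have vG: "v \<in> carrier G" using H.subset v by auto
      have K: "subgroup K G"
      proof (rule subgroupI)
        show "K \<subseteq> carrier G" using H.subset by (auto simp: K_def)
        show "K \<noteq> {}" using H.one_closed by (auto simp: K_def)
        show "inv a \<in> K" if "a \<in> K" for a
        proof -
          have a: "(a, 0) \<in> H" "a \<in> carrier G"
            using that H.mem_carrier[of "(a, 0)"] by (auto simp: K_def)
          have "inv\<^bsub>G \<times>\<times> integer_group\<^esub> (a, 0) \<in> H" using a(1) by (rule H.m_inv_closed)
          then show ?thesis using a by (simp add: K_def is_group)
        qed
        show "a \<otimes> b \<in> K" if "a \<in> K" "b \<in> K" for a b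
          using H.m_closed[of "(a, 0)" "(b, 0)"] that by (auto simp: K_def)
      qed
      have ext_H: "H = extended_subgroup G c K u" if "(u, int c) \<in> H" for u
        unfolding K_def using H(1) c that dvd by (rule subgroup_DirProd_integer_eq_extended_subgroup)
      have idx: "c * card (rcosets K) = n"
        using H(2) card_rcosets_extended_subgroup[OF K vG c] ext_H[OF v] by simp
      have slice: "{g. (g, int c) \<in> H} = K #> v"
        using extended_subgroup_slices(2)[OF K vG c] ext_H[OF v] by simp
      have "K \<in> \<K>" using K idx by (auto simp: \<K>_def subgroups_of_index_def)
      have C: "K #> v \<in> rcosets K" using K vG by (simp add: rcosetsI subgroup.subset)
      have "rep (K #> v) \<in> K #> v" using rep[OF K C] rcos_self K by metis
      then have "H = extended_subgroup G c K (rep (K #> v))" using slice ext_H by auto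
      moreover have "n div card (rcosets K) = c" using idx n by auto
      ultimately have "H = ext (K, K #> v)" by (simp add: ext_def)
      then show "H \<in> ext ` (SIGMA K:\<K>. rcosets K)" using \<open>K \<in> \<K>\<close> C by blast
    qed
  qed
  have finD: "finite {d. d dvd n}" using n by (simp add: finite_divisors_nat)
  have fin\<K>: "finite \<K>" unfolding \<K>_def using finD fin d1 by auto
  have finR: "finite (rcosets K)" if "K \<in> \<K>" for K
    using d1[OF in\<K>(2)[OF that]] by (intro card_ge_0_finite) simp
  show "finite (subgroups_of_index (G \<times>\<times> integer_group) n)"
    using bij_betw_finite[OF bij] fin\<K> finR by auto
  have "card (subgroups_of_index (G \<times>\<times> integer_group) n) = (\<Sum>K\<in>\<K>. card (rcosets K))"
    using bij_betw_same_card[OF bij] fin\<K> finR by simp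
  also have "\<dots> = (\<Sum>d | d dvd n. \<Sum>K\<in>subgroups_of_index G d. card (rcosets K))"
    unfolding \<K>_def using finD fin d1 by (intro sum.UNION_disjoint) (auto simp: subgroups_of_index_def)
  also have "\<dots> = (\<Sum>d | d dvd n. d * card (subgroups_of_index G d))"
    by (intro sum.cong refl) (simp add: subgroups_of_index_def)
  finally show "card (subgroups_of_index (G \<times>\<times> integer_group) n) =
      (\<Sum>d | d dvd n. d * card (subgroups_of_index G d))" .
qed

end

lemma int_lattice_Suc_iso:
  "(\<lambda>x. (restrict x {..<r}, x r)) \<in> iso (int_lattice (Suc r)) (int_lattice r \<times>\<times> integer_group)"
proof (rule isoI)
  show "(\<lambda>x. (restrict x {..<r}, x r)) \<in> hom (int_lattice (Suc r)) (int_lattice r \<times>\<times> integer_group)"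
    by (rule homI) (auto simp: int_lattice_def fun_eq_iff)
  show "bij_betw (\<lambda>x. (restrict x {..<r}, x r)) (carrier (int_lattice (Suc r)))
      (carrier (int_lattice r \<times>\<times> integer_group))"
    by (rule bij_betw_byWitness[where f' = "\<lambda>(y, z). y(r := z)"])
      (auto simp: int_lattice_def fun_eq_iff PiE_iff extensional_def less_Suc_eq)
qed

lemma comm_group_int_lattice: "comm_group (int_lattice r)"
proof -
  have "group (int_lattice r)" unfolding int_lattice_def by simp
  then show ?thesis
    by (rule group.group_comm_groupI) (auto simp: int_lattice_def fun_eq_iff)
qed

lemma bij_betw_subgroups_of_index_int_lattice:
  "bij_betw ((`) (\<lambda>x. (restrict x {..<r}, x r)))
     (subgroups_of_index (int_lattice (Suc r)) n)
     (subgroups_of_index (int_lattice r \<times>\<times> integer_group) n)"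
  using comm_group.axioms(2)[OF comm_group_int_lattice]
  by (intro iso_bij_betw_subgroups_of_index int_lattice_Suc_iso DirProd_group) auto

lemma finite_subgroups_of_index_int_lattice:
  "n \<ge> 1 \<Longrightarrow> finite (subgroups_of_index (int_lattice r) n)"
proof (induction r arbitrary: n)
  case 0
  have "H \<subseteq> carrier (int_lattice 0)" if "H \<in> subgroups_of_index (int_lattice 0) n" for H
    using that by (auto simp: subgroups_of_index_def dest: subgroup.subset)
  moreover have "finite (carrier (int_lattice 0))" by (simp add: int_lattice_def)
  ultimately show ?case by (meson Pow_iff finite_Pow_iff finite_subset subsetI)
next
  case (Suc r)
  interpret comm_group "int_lattice r" by (rule comm_group_int_lattice)
  have "finite (subgroups_of_index (int_lattice r \<times>\<times> integer_group) n)"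
    using Suc by (intro subgroups_of_index_DirProd_integer)
  then show ?case
    using bij_betw_finite[OF bij_betw_subgroups_of_index_int_lattice] by blast
qed

lemma subgroup_count_0: "subgroup_count 0 n = (if n = 1 then 1 else 0)"
proof -
  interpret comm_group "int_lattice 0" by (rule comm_group_int_lattice)
  have carr: "carrier (int_lattice 0) = {\<one>\<^bsub>int_lattice 0\<^esub>}" by (auto simp: int_lattice_def)
  have sub: "subgroup H (int_lattice 0) \<longleftrightarrow> H = carrier (int_lattice 0)" for H
  proof
    assume "subgroup H (int_lattice 0)"
    then have "H \<subseteq> carrier (int_lattice 0)" "\<one>\<^bsub>int_lattice 0\<^esub> \<in> H"
      by (auto dest: subgroup.subset subgroup.one_closed)
    then show "H = carrier (int_lattice 0)" unfolding carr by blast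
  qed (simp add: subgroup_self)
  have "rcosets\<^bsub>int_lattice 0\<^esub> carrier (int_lattice 0) = {carrier (int_lattice 0)}"
    using carr by (auto simp: RCOSETS_def r_coset_def)
  then show ?thesis unfolding subgroup_count_def sub by (auto simp: Collect_conv_if)
qed

lemma subgroup_count_Suc:
  assumes "n \<ge> 1"
  shows "subgroup_count (Suc r) n = (\<Sum>d | d dvd n. d * subgroup_count r d)"
proof -
  interpret comm_group "int_lattice r" by (rule comm_group_int_lattice)
  have "subgroup_count (Suc r) n = card (subgroups_of_index (int_lattice r \<times>\<times> integer_group) n)"
    unfolding subgroup_count_def subgroups_of_index_def[symmetric]
    by (rule bij_betw_same_card[OF bij_betw_subgroups_of_index_int_lattice])
  also have "\<dots> = (\<Sum>d | d dvd n. d * subgroup_count r d)"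
    unfolding subgroup_count_def subgroups_of_index_def[symmetric]
    using assms by (intro subgroups_of_index_DirProd_integer(2) finite_subgroups_of_index_int_lattice)
  finally show ?thesis .
qed

section \<open>Multiplicativity and growth of divisor sums\<close>

lemma sum_divisors_mult_coprime:
  fixes m n :: nat
  assumes "coprime m n" "m \<ge> 1" "n \<ge> 1"
  shows "(\<Sum>d | d dvd m * n. f d) = (\<Sum>(a, b)\<in>{a. a dvd m} \<times> {b. b dvd n}. f (a * b))"
proof -
  have gcds: "gcd (a * b) m = a" "gcd (a * b) n = b" if ab: "a dvd m" "b dvd n" for a b
  proof -
    have "coprime b m" "coprime a n"
      using assms(1) ab by (meson coprime_commute coprime_divisors dvd_refl)+
    then have "gcd (a * b) m = gcd a m" "gcd (a * b) n = gcd b n"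
      by (simp_all add: gcd_mult_left_right_cancel gcd_mult_left_left_cancel coprime_commute)
    then show "gcd (a * b) m = a" "gcd (a * b) n = b"
      using ab by (simp_all add: gcd_nat.absorb1)
  qed
  show ?thesis
  proof (rule sum.reindex_bij_witness[where i = "\<lambda>(a, b). a * b" and j = "\<lambda>d. (gcd d m, gcd d n)"], goal_cases)
    case (1 d)
    then obtain a b where "d = a * b" "a dvd m" "b dvd n"
      using division_decomp[of d m n] by auto
    then show ?case by (simp add: gcds)
  next
    case (3 ab)
    then show ?case by (auto simp: gcds)
  next
    case (5 d)
    then obtain a b where "d = a * b" "a dvd m" "b dvd n"
      using division_decomp[of d m n] by auto
    then show ?case by (simp add: gcds)
  qed (auto intro: mult_dvd_mono)
qed

lemma sum_divisors_multiplicative: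
  fixes g :: "nat \<Rightarrow> nat"
  assumes "\<And>a b. coprime a b \<Longrightarrow> a \<ge> 1 \<Longrightarrow> b \<ge> 1 \<Longrightarrow> g (a * b) = g a * g b"
    and "coprime m n" "m \<ge> 1" "n \<ge> 1"
  shows "(\<Sum>d | d dvd m * n. g d) = (\<Sum>d | d dvd m. g d) * (\<Sum>d | d dvd n. g d)"
proof -
  have "(\<Sum>d | d dvd m * n. g d) = (\<Sum>(a, b)\<in>{a. a dvd m} \<times> {b. b dvd n}. g a * g b)"
    unfolding sum_divisors_mult_coprime[OF assms(2-4)]
  proof (intro sum.cong refl, clarify)
    fix a b assume "a dvd m" "b dvd n"
    then show "g (a * b) = g a * g b"
      using assms by (metis coprime_divisors dvd_0_left less_one not_le)
  qed
  then show ?thesis by (simp add: sum_product sum.cartesian_product)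
qed

text \<open>
  Strong induction takes the place of Moebius inversion: if both sides of the hypothesis are
  expanded over the divisors \<open>a b\<close> of \<open>m n\<close>, all terms except the one with \<open>a = m\<close> and \<open>b = n\<close>
  agree by the induction hypothesis.
\<close>

lemma multiplicative_of_sum_divisors_multiplicative:
  fixes g :: "nat \<Rightarrow> nat"
  assumes F: "\<And>m n. coprime m n \<Longrightarrow> m \<ge> 1 \<Longrightarrow> n \<ge> 1 \<Longrightarrow>
      (\<Sum>d | d dvd m * n. g d) = (\<Sum>d | d dvd m. g d) * (\<Sum>d | d dvd n. g d)"
    and "coprime m n" "m \<ge> 1" "n \<ge> 1"
  shows "g (m * n) = g m * g n"
  using assms(2-4)
proof (induction "m * n" arbitrary: m n rule: less_induct)
  case less
  let ?D = "{a. a dvd m} \<times> {b. b dvd n}"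
  have fin: "finite ?D" using less.prems by simp
  have mn: "(m, n) \<in> ?D" by simp
  have smaller: "g (a * b) = g a * g b" if "(a, b) \<in> ?D - {(m, n)}" for a b
  proof -
    have ab: "a dvd m" "b dvd n" "a \<noteq> m \<or> b \<noteq> n" using that by auto
    then have pos: "a \<ge> 1" "b \<ge> 1" using less.prems by (metis dvd_0_left less_one not_le)+
    have "a \<le> m" "b \<le> n" using ab less.prems by (auto intro: dvd_imp_le)
    then have "a * b < m * n"
      using ab(3) pos less.prems by (metis le_neq_implies_less mult_le_less_imp_less mult_less_le_imp_less less_eq_Suc_le One_nat_def zero_le)
    moreover have "coprime a b" using ab less.prems coprime_divisors by blast
    ultimately show ?thesis using less.hyps pos by blast
  qed
  have "g (m * n) + (\<Sum>(a, b)\<in>?D - {(m, n)}. g a * g b) = (\<Sum>(a, b)\<in>?D. g (a * b))"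
  proof -
    have "(\<Sum>(a, b)\<in>?D - {(m, n)}. g a * g b) = (\<Sum>(a, b)\<in>?D - {(m, n)}. g (a * b))"
    proof (intro sum.cong refl)
      fix x assume "x \<in> ?D - {(m, n)}"
      then show "(case x of (a, b) \<Rightarrow> g a * g b) = (case x of (a, b) \<Rightarrow> g (a * b))"
        using smaller by (cases x) (simp only: prod.case)
    qed
    then show ?thesis by (simp only: sum.remove[OF fin mn] prod.case)
  qed
  also have "\<dots> = (\<Sum>(a, b)\<in>?D. g a * g b)"
    using F[OF less.prems] sum_divisors_mult_coprime[OF less.prems, of g]
    by (simp add: sum_product sum.cartesian_product)
  also have "\<dots> = g m * g n + (\<Sum>(a, b)\<in>?D - {(m, n)}. g a * g b)"
    by (subst sum.remove[OF fin mn]) simp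
  finally show ?case by simp
qed

lemma sum_divisors_prime_power:
  fixes p :: nat
  assumes "prime p"
  shows "(\<Sum>d | d dvd p ^ k. f d) = (\<Sum>j\<le>k. f (p ^ j))"
proof -
  have "{d. d dvd p ^ k} = (\<lambda>j. p ^ j) ` {..k}"
    using divides_primepow_nat[OF assms] by auto
  moreover have "inj_on (\<lambda>j. p ^ j) {..k}"
    using assms by (intro inj_onI) (rule prime_power_inj)
  ultimately show ?thesis by (simp add: sum.reindex)
qed

lemma subgroup_count_multiplicative:
  "coprime m n \<Longrightarrow> m \<ge> 1 \<Longrightarrow> n \<ge> 1 \<Longrightarrow>
   subgroup_count r (m * n) = subgroup_count r m * subgroup_count r n"
proof (induction r arbitrary: m n)
  case 0
  then show ?case by (simp add: subgroup_count_0)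
next
  case (Suc r)
  then show ?case
    by (simp add: subgroup_count_Suc sum_divisors_multiplicative)
qed

lemma subgroup_count_1_right [simp]: "subgroup_count r (Suc 0) = 1"
  by (induction r) (simp_all add: subgroup_count_0 subgroup_count_Suc)

lemma subgroup_count_1_left: "n \<ge> 1 \<Longrightarrow> subgroup_count (Suc 0) n = 1"
  using subgroup_count_Suc[of n 0] by (simp add: subgroup_count_0 if_distrib sum.delta' cong: if_cong)

text \<open>
  Replacing each divisor by its codivisor turns the sum into \<open>n\<close> times \<open>\<Sum> 1 / d\<close>. Because of
  \<open>d \<le> n\<close>, the number \<open>1 / d\<close> is at most \<open>n\<^sup>e\<close> times the power of \<open>d\<close> with exponent \<open>- 1 - e\<close>, and
  the sum of these powers over all \<open>d\<close> converges to the constant \<open>C\<close>.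
\<close>

lemma sum_divisors_le_powr:
  assumes e: "e > 0"
  obtains C :: real where "C \<ge> 0" "\<And>n. n \<ge> 1 \<Longrightarrow> real (\<Sum>d | d dvd n. d) \<le> C * real n powr (1 + e)"
proof
  let ?C = "\<Sum>d. real d powr (- 1 - e)"
  have summ: "summable (\<lambda>d. real d powr (- 1 - e))"
    using e by (simp add: summable_real_powr_iff)
  show "?C \<ge> 0" by (intro suminf_nonneg summ) simp
  fix n :: nat assume n: "n \<ge> 1"
  have finD: "finite {d. d dvd n}" using n by simp
  have d1: "d \<ge> 1" if "d dvd n" for d using that n by (metis dvd_0_left less_one not_le)
  have "real (\<Sum>d | d dvd n. d) = (\<Sum>d | d dvd n. real n / real d)"
    unfolding of_nat_sum
    by (rule sum.reindex_bij_witness[of _ "\<lambda>d. n div d" "\<lambda>d. n div d"])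
      (use n in \<open>auto simp: real_of_nat_div div_dvd_iff_mult\<close>)
  also have "\<dots> \<le> (\<Sum>d | d dvd n. real n powr (1 + e) * real d powr (- 1 - e))"
  proof (rule sum_mono)
    fix d assume "d \<in> {d. d dvd n}"
    then have d: "d \<ge> 1" "d \<le> n" using d1 n by (auto intro: dvd_imp_le)
    have "real n / real d = real n * real d powr e * real d powr (- 1 - e)"
      using d by (simp add: powr_diff powr_minus field_simps)
    also have "\<dots> \<le> real n * real n powr e * real d powr (- 1 - e)"
      using d e by (intro mult_right_mono mult_left_mono powr_mono2) auto
    also have "real n * real n powr e = real n powr (1 + e)"
      using n by (simp add: powr_add)
    finally show "real n / real d \<le> real n powr (1 + e) * real d powr (- 1 - e)" .
  qed
  also have "\<dots> = real n powr (1 + e) * (\<Sum>d | d dvd n. real d powr (- 1 - e))"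
    by (simp add: sum_distrib_left)
  also have "\<dots> \<le> real n powr (1 + e) * ?C"
    using finD by (intro mult_left_mono sum_le_suminf summ) auto
  finally show "real (\<Sum>d | d dvd n. d) \<le> ?C * real n powr (1 + e)" by (simp add: mult.commute)
qed

text \<open>
  Each step of the recursion in the rank costs one factor, the bound for the sum of the divisors
  of \<open>n\<close>.
\<close>

lemma subgroup_count_le_power:
  assumes C: "C \<ge> 0" "\<And>n. n \<ge> 1 \<Longrightarrow> real (\<Sum>d | d dvd n. d) \<le> C * real n powr (1 + e)" and e: "e > 0"
  shows "n \<ge> 1 \<Longrightarrow> real (subgroup_count (Suc r) n) \<le> (C * real n powr (1 + e)) ^ r"
proof (induction r arbitrary: n)
  case 0
  then show ?case by (simp add: subgroup_count_1_left)
next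
  case (Suc r)
  have d1: "d \<ge> 1" if "d dvd n" for d using that Suc.prems by (metis dvd_0_left less_one not_le)
  have "real (subgroup_count (Suc (Suc r)) n) = (\<Sum>d | d dvd n. real d * real (subgroup_count (Suc r) d))"
    using subgroup_count_Suc[OF Suc.prems, of "Suc r"] by simp
  also have "\<dots> \<le> (\<Sum>d | d dvd n. real d * (C * real n powr (1 + e)) ^ r)"
  proof (rule sum_mono)
    fix d assume "d \<in> {d. d dvd n}"
    then have d: "d \<ge> 1" "d \<le> n" using d1 Suc.prems by (auto intro: dvd_imp_le)
    have "real (subgroup_count (Suc r) d) \<le> (C * real d powr (1 + e)) ^ r"
      using Suc.IH d by simp
    also have "\<dots> \<le> (C * real n powr (1 + e)) ^ r"
      using C(1) d e by (intro power_mono mult_left_mono powr_mono2) auto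
    finally show "real d * real (subgroup_count (Suc r) d) \<le> real d * (C * real n powr (1 + e)) ^ r"
      by (intro mult_left_mono) auto
  qed
  also have "\<dots> = real (\<Sum>d | d dvd n. d) * (C * real n powr (1 + e)) ^ r"
    by (simp add: sum_distrib_right)
  also have "\<dots> \<le> (C * real n powr (1 + e)) * (C * real n powr (1 + e)) ^ r"
    using C Suc.prems by (intro mult_right_mono) auto
  finally show ?case by simp
qed

section \<open>Descents, major index and Gaussian binomial coefficients\<close>

text \<open>
  The Gaussian binomial coefficient of \<open>l + k\<close> over \<open>k\<close>, defined by one of the two \<open>q\<close>-Pascal
  rules. The symmetric parametrisation suits both uses: the recursion in \<open>l\<close> is that of the
  subgroup counts at prime powers, the recursion in \<open>k\<close> is that of the word sums.
\<close>

fun gauss_binom :: "'a::comm_ring_1 \<Rightarrow> nat \<Rightarrow> nat \<Rightarrow> 'a" where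
  "gauss_binom q 0 k = 1"
| "gauss_binom q (Suc l) 0 = 1"
| "gauss_binom q (Suc l) (Suc k) = gauss_binom q (Suc l) k + q ^ Suc k * gauss_binom q l (Suc k)"

lemma gauss_binom_0_right [simp]: "gauss_binom q l 0 = 1"
  by (cases l) auto

text \<open>
  Both ways of applying the two rules in succession lead to the same expression, so the dual rule
  follows from its own smaller instances.
\<close>

lemma gauss_binom_pascal_dual:
  "gauss_binom q (Suc l) (Suc k) = gauss_binom q l (Suc k) + q ^ Suc l * gauss_binom q (Suc l) k"
proof (induction "l + k" arbitrary: l k rule: less_induct)
  case less
  have lower_k: "gauss_binom q (Suc l) k = gauss_binom q l k + (q ^ Suc l * gauss_binom q (Suc l) (k - 1))"
    if "k > 0"
    using less(1)[of l "k - 1"] that by (cases k) auto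
  have lower_l: "gauss_binom q l (Suc k) = gauss_binom q (l - 1) (Suc k) + q ^ l * gauss_binom q l k"
    if "l > 0"
    using less(1)[of "l - 1" k] that by (cases l) auto
  show ?case
  proof (cases "l = 0 \<or> k = 0")
    case True
    then consider "k = 0" | k' where "l = 0" "k = Suc k'" by (metis not0_implies_Suc)
    then show ?thesis
    proof cases
      case 1
      then show ?thesis using lower_l by (cases l) (auto simp: algebra_simps)
    next
      case 2
      then have "gauss_binom q 1 k = 1 + q * gauss_binom q 1 k'"
        using lower_k by simp
      moreover have "gauss_binom q 1 k = gauss_binom q 1 k' + q ^ k" "gauss_binom q 1 (Suc k) = gauss_binom q 1 k + q ^ Suc k"
        using 2 by auto
      ultimately have "gauss_binom q 1 (Suc k) = 1 + q * gauss_binom q 1 k"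
        by (simp add: algebra_simps)
      then show ?thesis using 2 by simp
    qed
  next
    case False
    then obtain l' k' where lk: "l = Suc l'" "k = Suc k'" by (metis not0_implies_Suc)
    have "gauss_binom q (Suc l) (Suc k) = gauss_binom q (Suc l) k + q ^ Suc k * gauss_binom q l (Suc k)"
      by (rule gauss_binom.simps)
    also have "\<dots> = gauss_binom q l k + q ^ Suc l * gauss_binom q (Suc l) k'
        + q ^ Suc k * (gauss_binom q l' (Suc k) + q ^ l * gauss_binom q l k)"
      using lower_k lower_l by (simp only: lk) simp
    also have "\<dots> = (gauss_binom q l k + q ^ Suc k * gauss_binom q l' (Suc k))
        + q ^ Suc l * (gauss_binom q (Suc l) k' + q ^ k * gauss_binom q l k)"
      by (simp add: algebra_simps)
    also have "gauss_binom q l k + q ^ Suc k * gauss_binom q l' (Suc k) = gauss_binom q l (Suc k)"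
      unfolding lk by simp
    also have "gauss_binom q (Suc l) k' + q ^ k * gauss_binom q l k = gauss_binom q (Suc l) k"
      unfolding lk by simp
    finally show ?thesis .
  qed
qed

lemma gauss_binom_Suc_left:
  "gauss_binom q (Suc l) k = (\<Sum>j\<le>k. q ^ j * gauss_binom q l j)"
  by (induction k) auto

lemma gauss_binom_Suc_right:
  "gauss_binom q l (Suc k) = (\<Sum>j\<le>l. q ^ j * gauss_binom q j k)"
  by (induction l) (auto simp: gauss_binom_pascal_dual simp del: gauss_binom.simps(3))

text \<open>
  The sum of \<open>q\<close> to the power \<open>f\<^sub>1 + \<dots> + f\<^sub>N\<close> over all weakly decreasing sequences
  \<open>k \<ge> f\<^sub>1 \<ge> \<dots> \<ge> f\<^sub>N \<ge> 0\<close> that decrease strictly at the descents of \<open>w\<close>. The recursion splits off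
  the block of positions with \<open>f = 0\<close>, on which \<open>w\<close> is weakly increasing, and lowers the values at
  the \<open>j\<close> remaining positions by one, which contributes \<open>q\<^sup>j\<close>.
\<close>

primrec block_sum :: "'a::comm_ring_1 \<Rightarrow> nat \<Rightarrow> nat list \<Rightarrow> 'a" where
  "block_sum q 0 w = (if sorted w then 1 else 0)"
| "block_sum q (Suc k) w =
     (\<Sum>j\<in>{j. j \<le> length w \<and> sorted (drop j w)}. q ^ j * block_sum q k (take j w))"

lemma finite_suffix_positions [simp]: "finite {j. j \<le> n \<and> P j}" for n :: nat
  by (rule finite_subset[of _ "{..n}"]) auto

lemma block_sum_Nil [simp]: "block_sum q k [] = 1"
proof (induction k)
  case (Suc k)
  have "{j. j \<le> length ([]::nat list) \<and> sorted (drop j ([]::nat list))} = {0}" by auto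
  then show ?case using Suc by simp
qed auto

text \<open>
  Appending a letter without a descent admits the same last blocks as before, each with the new
  letter at its end, and in addition the empty block, which yields the first summand.
\<close>

lemma block_sum_ascent:
  assumes "w = [] \<or> last w \<le> a"
  shows "block_sum q 0 (w @ [a]) = block_sum q 0 w"
    and "block_sum q (Suc k) (w @ [a]) =
           q ^ Suc (length w) * block_sum q k (w @ [a]) + block_sum q (Suc k) w"
proof -
  have bound: "x \<le> a" if "sorted (drop j w)" "x \<in> set (drop j w)" for j x
  proof -
    from that have "drop j w \<noteq> []" by auto
    then have "w \<noteq> []" "last (drop j w) = last w" by auto
    moreover have "x \<le> last (drop j w)"
    proof -
      from that(2) obtain i where "i < length (drop j w)" "x = drop j w ! i"
        by (metis in_set_conv_nth)
      then show ?thesis using that(1) \<open>drop j w \<noteq> []\<close>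
        by (simp add: last_conv_nth del: length_drop nth_drop) (rule sorted_nth_mono; simp)
    qed
    ultimately show ?thesis using assms by auto
  qed
  show "block_sum q 0 (w @ [a]) = block_sum q 0 w"
    using bound[of 0] by (auto simp: sorted_append)
  have "{j. j \<le> length (w @ [a]) \<and> sorted (drop j (w @ [a]))} =
        insert (Suc (length w)) {j. j \<le> length w \<and> sorted (drop j w)}"
    using bound by (auto simp: sorted_append le_Suc_eq)
  then show "block_sum q (Suc k) (w @ [a]) =
           q ^ Suc (length w) * block_sum q k (w @ [a]) + block_sum q (Suc k) w"
    by (auto intro!: sum.cong)
qed

text \<open>
  After a descent the last block is empty or consists of the new letter alone.
\<close>

lemma block_sum_descent:
  assumes "w \<noteq> []" "last w > a"
  shows "block_sum q 0 (w @ [a]) = 0"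
    and "block_sum q (Suc k) (w @ [a]) =
           q ^ Suc (length w) * block_sum q k (w @ [a]) + q ^ length w * block_sum q k w"
proof -
  have bound: "\<not> (\<forall>x \<in> set (drop j w). x \<le> a)" if "j < length w" for j
    using that assms by (metis drop_eq_Nil2 last_drop last_in_set not_le)
  show "block_sum q 0 (w @ [a]) = 0"
    using bound[of 0] assms by (auto simp: sorted_append)
  have "\<not> sorted (drop j (w @ [a]))" if "j < length w" for j
    using bound[OF that] that by (auto simp: sorted_append)
  then have "{j. j \<le> length (w @ [a]) \<and> sorted (drop j (w @ [a]))} = {Suc (length w), length w}"
    by (auto simp: le_Suc_eq simp del: drop_append) (metis le_neq_implies_less, simp)
  then show "block_sum q (Suc k) (w @ [a]) =
           q ^ Suc (length w) * block_sum q k (w @ [a]) + q ^ length w * block_sum q k w"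
    by auto
qed

lemma Des_snoc:
  "Des (w @ [a]) = (if w \<noteq> [] \<and> last w > a then insert (length w) (Des w) else Des w)"
proof -
  have "i \<in> Des (w @ [a]) \<longleftrightarrow> i \<in> Des w \<or> (w \<noteq> [] \<and> last w > a \<and> i = length w)" for i
    by (cases "w = []"; cases "i = length w") (auto simp: Des_def nth_append last_conv_nth Suc_le_eq)
  then show ?thesis by auto
qed

lemma Des_less_length: "i \<in> Des w \<Longrightarrow> i < length w"
  by (simp add: Des_def)

lemma finite_Des [simp]: "finite (Des w)"
  by (rule finite_subset[of _ "{..<length w}"]) (auto dest: Des_less_length)

lemma des_snoc: "des (w @ [a]) = des w + (if w \<noteq> [] \<and> last w > a then 1 else 0)"
proof -
  have "length w \<notin> Des w" using Des_less_length by blast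
  then show ?thesis by (simp add: des_def Des_snoc)
qed

lemma maj_snoc: "maj (w @ [a]) = maj w + (if w \<noteq> [] \<and> last w > a then length w else 0)"
proof -
  have "length w \<notin> Des w" using Des_less_length by blast
  then show ?thesis by (simp add: maj_def Des_snoc)
qed

text \<open>
  The recurrence says that \<open>f\<close> is the Cauchy product of \<open>g\<close> with a geometric series.
\<close>

lemma sums_geometric_recurrence:
  fixes f g :: "nat \<Rightarrow> complex"
  assumes f0: "f 0 = g 0" and fS: "\<And>k. f (Suc k) = c * f k + g (Suc k)" and c: "norm c < 1"
    and g: "summable (\<lambda>k. norm (g k))" "g sums S"
  shows "summable (\<lambda>k. norm (f k))" "f sums (S / (1 - c))"
proof -
  have f: "f k = (\<Sum>i\<le>k. c ^ i * g (k - i))" for k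
  proof (induction k)
    case (Suc k)
    have "(\<Sum>i\<le>Suc k. c ^ i * g (Suc k - i)) = g (Suc k) + c * (\<Sum>i\<le>k. c ^ i * g (k - i))"
      by (subst sum.atMost_Suc_shift) (simp add: sum_distrib_left mult.assoc)
    then show ?case using Suc fS by simp
  qed (simp add: f0)
  have geo: "summable (\<lambda>k. norm (c ^ k))" using c by (simp add: norm_power)
  have "summable (\<lambda>k. \<Sum>i\<le>k. norm (c ^ i) * norm (g (k - i)))"
    by (rule summable_Cauchy_product) (use geo g in simp_all)
  then show "summable (\<lambda>k. norm (f k))"
    by (rule summable_comparison_test'[of _ 0])
      (auto simp: f norm_mult norm_power intro!: order_trans[OF norm_sum])
  have "f sums ((\<Sum>k. c ^ k) * (\<Sum>k. g k))"
    unfolding f using Cauchy_product_sums[OF geo g(1)] .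
  moreover have "(\<Sum>k. c ^ k) = 1 / (1 - c)" using suminf_geometric[OF c] .
  moreover have "(\<Sum>k. g k) = S" using g(2) by (simp add: sums_iff)
  ultimately show "f sums (S / (1 - c))" by simp
qed

text \<open>
  Induction on the word from the right. For \<open>\<Phi>\<close> the generating function, the two recurrences give
  \<open>\<Phi> (w @ [a]) (1 - x q\<^sup>N) = \<Phi> w\<close> without and \<open>x q\<close> to the power \<open>N - 1\<close> times \<open>\<Phi> w\<close> with a
  descent at the last position \<open>N - 1\<close>, where \<open>N\<close> is the new length: a descent is counted once in
  \<open>des\<close> and with its position in \<open>maj\<close>.
\<close>

lemma block_sum_generating_function:
  fixes q x :: complex
  assumes "\<And>i. i \<le> length w \<Longrightarrow> norm (x * q ^ i) < 1"
  shows "summable (\<lambda>k. norm (block_sum q k w * x ^ k)) \<and>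
         (\<lambda>k. block_sum q k w * x ^ k) sums (x ^ des w * q ^ maj w / (\<Prod>i\<le>length w. 1 - x * q ^ i))"
  using assms
proof (induction w rule: rev_induct)
  case Nil
  have "norm x < 1" using Nil[of 0] by simp
  then show ?case
    using geometric_sums[of x] by (simp add: des_def maj_def Des_def norm_power)
next
  case (snoc a w)
  let ?f = "\<lambda>k. block_sum q k (w @ [a]) * x ^ k"
  let ?g = "\<lambda>k. block_sum q k w * x ^ k"
  let ?c = "x * q ^ Suc (length w)"
  let ?S = "x ^ des w * q ^ maj w / (\<Prod>i\<le>length w. 1 - x * q ^ i)"
  have g: "summable (\<lambda>k. norm (?g k))" "?g sums ?S"
    using snoc by auto
  have c: "norm ?c < 1" using snoc(2)[of "Suc (length w)"] by simp
  show ?case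
  proof (cases "w \<noteq> [] \<and> last w > a")
    case False
    then have asc: "w = [] \<or> last w \<le> a" by auto
    have rec: "?f (Suc k) = ?c * ?f k + ?g (Suc k)" for k
      unfolding block_sum_ascent(2)[OF asc] by (simp add: algebra_simps del: block_sum.simps)
    have f0: "?f 0 = ?g 0" using block_sum_ascent(1)[OF asc, of q] by simp
    have des_maj: "des (w @ [a]) = des w" "maj (w @ [a]) = maj w"
      using asc False by (auto simp: des_snoc maj_snoc)
    show ?thesis
      using sums_geometric_recurrence[of ?f ?g ?c, OF f0 rec c g]
      by (simp add: des_maj del: block_sum.simps power_Suc)
  next
    case True
    let ?g' = "\<lambda>k. if k = 0 then 0 else x * q ^ length w * ?g (k - 1)"
    have rec: "?f (Suc k) = ?c * ?f k + ?g' (Suc k)" for k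
      using block_sum_descent(2)[of w a q k] True
      by (simp add: algebra_simps del: block_sum.simps)
    have f0: "?f 0 = ?g' 0" using block_sum_descent(1)[of w a q] True by simp
    have g': "?g' sums (x * q ^ length w * ?S)"
      using sums_mult[OF g(2), of "x * q ^ length w"] sums_Suc_iff[of ?g' "x * q ^ length w * ?S"] by simp
    have g'': "summable (\<lambda>k. norm (?g' k))"
      using summable_mult[OF g(1), of "norm (x * q ^ length w)"]
        summable_Suc_iff[of "\<lambda>k. norm (?g' k)"] by (simp add: norm_mult)
    have des_maj: "des (w @ [a]) = Suc (des w)" "maj (w @ [a]) = maj w + length w"
      using True by (auto simp: des_snoc maj_snoc)
    have S: "x * q ^ length w * ?S / (1 - ?c) =
        x ^ des (w @ [a]) * q ^ maj (w @ [a]) / (\<Prod>i\<le>length (w @ [a]). 1 - x * q ^ i)"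
      unfolding des_maj by (simp add: power_add)
    show ?thesis
      using sums_geometric_recurrence[of ?f ?g' ?c, OF f0 rec c g'' g'] unfolding S by blast
  qed
qed

lemma finite_submultisets: "finite {K. K \<subseteq># M}"
proof (rule finite_subset)
  have "K \<in> mset ` {xs. set xs \<subseteq> set_mset M \<and> length xs \<le> size M}" if "K \<subseteq># M" for K
    using that by (metis (mono_tags, lifting) ex_mset imageI mem_Collect_eq set_mset_mono set_mset_mset size_mset size_mset_mono)
  then show "{K. K \<subseteq># M} \<subseteq> mset ` {xs. set xs \<subseteq> set_mset M \<and> length xs \<le> size M}" by blast
  show "finite (mset ` {xs. set xs \<subseteq> set_mset M \<and> length xs \<le> size M})"
    by (intro finite_imageI finite_lists_length_le) simp
qed

text \<open>
  A word together with a sorted suffix amounts to a submultiset \<open>K\<close> and an arrangement of it,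
  because the suffix is determined as the sorted arrangement of what remains.
\<close>

lemma sum_block_sum_Suc:
  "(\<Sum>w\<in>permutations_of_multiset M. block_sum q (Suc k) w) =
   (\<Sum>K\<in>{K. K \<subseteq># M}. q ^ size K * (\<Sum>u\<in>permutations_of_multiset K. block_sum q k u))"
proof -
  have "(\<Sum>w\<in>permutations_of_multiset M. block_sum q (Suc k) w) =
      (\<Sum>(w, j)\<in>(SIGMA w:permutations_of_multiset M. {j. j \<le> length w \<and> sorted (drop j w)}).
          q ^ j * block_sum q k (take j w))"
    by (simp add: sum.Sigma)
  also have "\<dots> = (\<Sum>(K, u)\<in>(SIGMA K:{K. K \<subseteq># M}. permutations_of_multiset K).
          q ^ size K * block_sum q k u)"
  proof (rule sum.reindex_bij_witness[where
        i = "\<lambda>(K, u). (u @ sorted_list_of_multiset (M - K), size K)" and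
        j = "\<lambda>(w, j). (mset (take j w), take j w)"], goal_cases)
    case (1 wj)
    then obtain w j where wj: "wj = (w, j)" "mset w = M" "j \<le> length w" "sorted (drop j w)"
      by (auto simp: permutations_of_multiset_def)
    have "M = mset (take j w) + mset (drop j w)"
      using wj by (metis append_take_drop_id mset_append)
    then show ?case
      using wj by (simp add: sorted_sort_id)
  next
    case (2 wj)
    then obtain w j where wj: "wj = (w, j)" "mset w = M"
      by (auto simp: permutations_of_multiset_def)
    have "M = mset (take j w) + mset (drop j w)"
      using wj by (metis append_take_drop_id mset_append)
    then show ?case
      using wj by (simp add: permutations_of_multiset_def)
  next
    case (5 wj)
    then show ?case by auto
  qed (auto simp: permutations_of_multiset_def)
  also have "\<dots> = (\<Sum>K\<in>{K. K \<subseteq># M}. q ^ size K * (\<Sum>u\<in>permutations_of_multiset K. block_sum q k u))"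
    by (subst sum.Sigma[symmetric]) (auto simp: finite_submultisets sum_distrib_left)
  finally show ?thesis .
qed

lemma sum_submultisets_prod:
  fixes f :: "'b \<Rightarrow> nat \<Rightarrow> 'c::comm_semiring_1"
  assumes "finite A" "set_mset M \<subseteq> A"
  shows "(\<Sum>K\<in>{K. K \<subseteq># M}. \<Prod>i\<in>A. f i (count K i)) = (\<Prod>i\<in>A. \<Sum>j\<le>count M i. f i j)"
    (is "?l = _")
proof -
  let ?ms = "\<lambda>h. \<Sum>i\<in>A. replicate_mset (h i) i"
  have cnt: "count (?ms h) i = (if i \<in> A then h i else 0)" for h i
    using assms(1) by (auto simp: count_sum sum.If_cases)
  have "?l = (\<Sum>h\<in>PiE A (\<lambda>i. {..count M i}). \<Prod>i\<in>A. f i (h i))"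
  proof (rule sum.reindex_bij_witness[where i = ?ms and j = "\<lambda>K. restrict (count K) A"])
    fix K assume "K \<in> {K. K \<subseteq># M}"
    then have K: "K \<subseteq># M" by simp
    then have "count K i = 0" if "i \<notin> A" for i
      using assms(2) that by (metis count_eq_zero_iff mset_subset_eqD subsetD)
    then show "?ms (restrict (count K) A) = K"
      by (intro multiset_eqI) (simp add: cnt)
    show "restrict (count K) A \<in> PiE A (\<lambda>i. {..count M i})"
      using K by (auto simp: subseteq_mset_def)
    show "(\<Prod>i\<in>A. f i (restrict (count K) A i)) = (\<Prod>i\<in>A. f i (count K i))"
      by (intro prod.cong) auto
  next
    fix h assume h: "h \<in> PiE A (\<lambda>i. {..count M i})"
    show "restrict (count (?ms h)) A = h"
      using h by (auto simp: cnt fun_eq_iff restrict_def PiE_def extensional_def)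
    show "?ms h \<in> {K. K \<subseteq># M}"
      using h by (auto simp: subseteq_mset_def cnt)
  qed
  also have "\<dots> = (\<Prod>i\<in>A. \<Sum>j\<le>count M i. f i j)"
    by (subst prod_sum_PiE) (use assms in auto)
  finally show ?thesis .
qed

text \<open>
  Summed over all words, the letters decouple: both sides satisfy the same recursion in \<open>k\<close>, since
  a submultiset is an independent choice of the number of copies of each letter.
\<close>

lemma sum_block_sum_eq_prod_gauss_binom:
  assumes "finite A" "set_mset M \<subseteq> A"
  shows "(\<Sum>w\<in>permutations_of_multiset M. block_sum q k w) = (\<Prod>i\<in>A. gauss_binom q (count M i) k)"
  using assms(2)
proof (induction k arbitrary: M)
  case 0
  have "permutations_of_multiset M \<inter> {w. sorted w} = {sorted_list_of_multiset M}"
    by (auto simp: permutations_of_multiset_def sorted_list_of_multiset_mset sorted_sort_id)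
  then show ?case by (simp add: sum.If_cases)
next
  case (Suc k)
  have "(\<Sum>w\<in>permutations_of_multiset M. block_sum q (Suc k) w) =
      (\<Sum>K\<in>{K. K \<subseteq># M}. q ^ size K * (\<Prod>i\<in>A. gauss_binom q (count K i) k))"
    unfolding sum_block_sum_Suc
    using Suc by (intro sum.cong) (auto dest: set_mset_mono)
  also have "\<dots> = (\<Sum>K\<in>{K. K \<subseteq># M}. \<Prod>i\<in>A. q ^ count K i * gauss_binom q (count K i) k)"
  proof (intro sum.cong refl)
    fix K assume "K \<in> {K. K \<subseteq># M}"
    then have "set_mset K \<subseteq> A" using Suc(2) set_mset_mono by blast
    then have "size K = (\<Sum>i\<in>A. count K i)"
      unfolding size_multiset_overloaded_eq using assms(1)
      by (intro sum.mono_neutral_left) (auto simp: not_in_iff)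
    then show "q ^ size K * (\<Prod>i\<in>A. gauss_binom q (count K i) k) =
        (\<Prod>i\<in>A. q ^ count K i * gauss_binom q (count K i) k)"
      by (simp add: power_sum prod.distrib)
  qed
  also have "\<dots> = (\<Prod>i\<in>A. gauss_binom q (count M i) (Suc k))"
    unfolding gauss_binom_Suc_right using assms(1) Suc(2) by (rule sum_submultisets_prod)
  finally show ?case .
qed

section \<open>Euler products\<close>

definition smooth_numbers :: "nat set \<Rightarrow> nat set" where
  "smooth_numbers P = {n. n \<ge> 1 \<and> prime_factors n \<subseteq> P}"

lemma smooth_numbers_empty: "smooth_numbers {} = {1}"
  by (auto simp: smooth_numbers_def prime_factorization_empty_iff)

text \<open>
  Splitting off the exact power of \<open>p\<close>, by unique factorization.
\<close>

lemma bij_betw_smooth_numbers_insert: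
  assumes p: "prime p" "p \<notin> P"
  shows "bij_betw (\<lambda>(k, m). p ^ k * m) (UNIV \<times> smooth_numbers P) (smooth_numbers (insert p P))"
proof (rule bij_betw_byWitness[where f' = "\<lambda>n. (multiplicity p n, n div p ^ multiplicity p n)"])
  have p1: "p > 1" using p(1) prime_gt_1_nat by blast
  have mult: "multiplicity p (p ^ k * m) = k" if "m \<in> smooth_numbers P" for k m
  proof -
    have m: "m \<noteq> 0" "\<not> p dvd m"
      using that p by (auto simp: smooth_numbers_def in_prime_factors_iff)
    have "multiplicity p (p ^ k * m) = multiplicity p (p ^ k) + multiplicity p m"
      using p(1) m by (intro prime_elem_multiplicity_mult_distrib) auto
    moreover have "multiplicity p (p ^ k) = k"
      using p(1) by (intro multiplicity_same_power) auto
    ultimately show ?thesis using m by (simp add: not_dvd_imp_multiplicity_0)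
  qed
  show "\<forall>km\<in>UNIV \<times> smooth_numbers P. (\<lambda>n. (multiplicity p n, n div p ^ multiplicity p n)) ((\<lambda>(k, m). p ^ k * m) km) = km"
    using mult p1 by auto
  show "\<forall>n\<in>smooth_numbers (insert p P). (\<lambda>(k, m). p ^ k * m) (multiplicity p n, n div p ^ multiplicity p n) = n"
    by (auto simp: multiplicity_dvd)
  show "(\<lambda>(k, m). p ^ k * m) ` (UNIV \<times> smooth_numbers P) \<subseteq> smooth_numbers (insert p P)"
  proof clarsimp
    fix k m assume m: "m \<in> smooth_numbers P"
    then have "p ^ k * m \<ge> 1" using p1 by (auto simp: smooth_numbers_def)
    moreover have "q \<in> insert p P" if "prime q" "q dvd p ^ k * m" for q
    proof (cases "q dvd m")
      case True
      then show ?thesis using m that by (auto simp: smooth_numbers_def in_prime_factors_iff)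
    next
      case False
      then have "q dvd p" using that prime_dvd_mult_iff prime_dvd_power by blast
      then show ?thesis using that(1) p(1) primes_dvd_imp_eq by blast
    qed
    ultimately show "p ^ k * m \<in> smooth_numbers (insert p P)"
      by (auto simp: smooth_numbers_def in_prime_factors_iff)
  qed
  show "(\<lambda>n. (multiplicity p n, n div p ^ multiplicity p n)) ` smooth_numbers (insert p P)
      \<subseteq> UNIV \<times> smooth_numbers P"
  proof clarsimp
    fix n assume n: "n \<in> smooth_numbers (insert p P)"
    let ?m = "n div p ^ multiplicity p n"
    have eq: "n = p ^ multiplicity p n * ?m" by (simp add: multiplicity_dvd)
    have n0: "n \<noteq> 0" using n by (auto simp: smooth_numbers_def)
    have "?m \<noteq> 0" using eq n0 by (metis mult_0_right)
    have "\<not> p dvd ?m"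
      using n0 p1 multiplicity_decompose[of n p] by auto
    moreover have "q \<in> insert p P" if "q \<in> prime_factors ?m" for q
    proof -
      have "q \<in> prime_factors n"
        using that n0 eq by (metis dvd_triv_right dvd_prime_factors subsetD)
      then show ?thesis using n by (auto simp: smooth_numbers_def)
    qed
    ultimately show "?m \<in> smooth_numbers P"
      using \<open>?m \<noteq> 0\<close> by (auto simp: smooth_numbers_def in_prime_factors_iff)
  qed
qed

context
  fixes g :: "nat \<Rightarrow> complex"
  assumes g_1: "g 1 = 1"
    and g_mult: "\<And>m n. coprime m n \<Longrightarrow> m \<ge> 1 \<Longrightarrow> n \<ge> 1 \<Longrightarrow> g (m * n) = g m * g n"
    and g_summable: "summable (\<lambda>n. norm (g (Suc n)))"
begin

lemma range_Suc_eq: "range Suc = {1..}"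
  by (auto simp: image_iff dest: Suc_le_D)

lemma multiplicative_abs_summable_on:
  assumes "A \<subseteq> {1..}"
  shows "(\<lambda>n. norm (g n)) summable_on A"
proof -
  have "(\<lambda>n. norm (g (Suc n))) summable_on UNIV"
    using g_summable by (simp add: summable_on_UNIV_nonneg_real_iff)
  then have "(\<lambda>n. norm (g n)) summable_on range Suc"
    by (subst summable_on_reindex) (auto simp: o_def)
  then show ?thesis
    by (rule summable_on_subset_banach) (use assms range_Suc_eq in simp)
qed

lemma multiplicative_summable_on: "A \<subseteq> {1..} \<Longrightarrow> g summable_on A"
  using multiplicative_abs_summable_on abs_summable_summable by blast

lemma prime_power_has_sum:
  assumes "prime p"
  shows "((\<lambda>k. g (p ^ k)) has_sum (\<Sum>k. g (p ^ k))) UNIV"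
proof -
  have "inj (\<lambda>k. p ^ k)" using assms by (intro injI) (metis prime_gt_1_nat power_inject_exp)
  moreover have "g summable_on range (\<lambda>k. p ^ k)"
    using assms by (intro multiplicative_summable_on) (auto simp: Suc_le_eq prime_gt_0_nat)
  ultimately have "(\<lambda>k. g (p ^ k)) summable_on UNIV"
    by (subst (asm) summable_on_reindex) (auto simp: o_def)
  then show ?thesis
    using has_sum_imp_sums has_sum_infsum sums_unique by metis
qed

text \<open>
  A finite Euler product is the sum over the numbers with all prime factors in \<open>P\<close>; absolute
  convergence permits the rearrangement into a double sum when a prime is added.
\<close>

lemma has_sum_smooth_numbers:
  assumes "finite P" "\<And>p. p \<in> P \<Longrightarrow> prime p"
  shows "(g has_sum (\<Prod>p\<in>P. \<Sum>k. g (p ^ k))) (smooth_numbers P)"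
  using assms
proof (induction P rule: finite_induct)
  case empty
  then show ?case using has_sum_finite[of "{1}" g] g_1 by (simp add: smooth_numbers_empty)
next
  case (insert p P)
  have p: "prime p" using insert by simp
  have bij: "bij_betw (\<lambda>(k, m). p ^ k * m) (UNIV \<times> smooth_numbers P) (smooth_numbers (insert p P))"
    using p insert by (intro bij_betw_smooth_numbers_insert)
  let ?E = "\<lambda>p. \<Sum>k. g (p ^ k)"
  have factor: "g (p ^ k * m) = g (p ^ k) * g m" if "m \<in> smooth_numbers P" for k m
  proof (rule g_mult)
    have "\<not> p dvd m" using that p insert.hyps by (auto simp: smooth_numbers_def in_prime_factors_iff)
    then show "coprime (p ^ k) m" using p by (simp add: prime_imp_coprime)
  qed (use that p in \<open>auto simp: smooth_numbers_def Suc_le_eq prime_gt_0_nat\<close>)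
  have IH: "(g has_sum (\<Prod>p\<in>P. ?E p)) (smooth_numbers P)" using insert by simp
  have "((\<lambda>km. g ((\<lambda>(k, m). p ^ k * m) km)) has_sum (?E p * (\<Prod>p\<in>P. ?E p))) (UNIV \<times> smooth_numbers P)"
  proof (rule has_sum_SigmaI)
    show "((\<lambda>m. g ((\<lambda>(k, m). p ^ k * m) (k, m))) has_sum g (p ^ k) * (\<Prod>p\<in>P. ?E p)) (smooth_numbers P)" for k
      using has_sum_cmult_right[OF IH, of "g (p ^ k)"]
      by (rule has_sum_cong[THEN iffD1, rotated]) (simp add: factor)
    show "((\<lambda>k. g (p ^ k) * (\<Prod>p\<in>P. ?E p)) has_sum (?E p * (\<Prod>p\<in>P. ?E p))) UNIV"
      using has_sum_cmult_left[OF prime_power_has_sum[OF p]] .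
    have "g summable_on smooth_numbers (insert p P)"
      by (intro multiplicative_summable_on) (auto simp: smooth_numbers_def)
    then show "(\<lambda>km. g ((\<lambda>(k, m). p ^ k * m) km)) summable_on UNIV \<times> smooth_numbers P"
      by (subst summable_on_reindex_bij_betw[OF bij])
  qed
  then have "(g has_sum (?E p * (\<Prod>p\<in>P. ?E p))) (smooth_numbers (insert p P))"
    by (subst (asm) has_sum_reindex_bij_betw[OF bij])
  then show ?case using insert by simp
qed

text \<open>
  Apart from its leading term \<open>1\<close>, the Euler factor at \<open>p\<close> sums the terms of an absolutely
  convergent series at the powers of \<open>p\<close>, and different primes have no such powers in common.
  Hence the product converges absolutely, which gives the nonzero limit of the factors that do not
  vanish.
\<close>

lemma summable_euler_factors_minus_1:
  "summable (\<lambda>p. norm ((if prime p then \<Sum>k. g (p ^ k) else 1) - 1))"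
proof -
  let ?h = "\<lambda>(p, k). p ^ Suc k :: nat"
  have inj: "inj_on ?h ({p. prime p} \<times> UNIV)"
    by (rule inj_onI) (auto simp: prime_power_inj'' simp del: power_Suc)
  have "(\<lambda>n. norm (g n)) summable_on ?h ` ({p. prime p} \<times> UNIV)"
    by (intro multiplicative_abs_summable_on) (auto simp: Suc_le_eq prime_gt_0_nat)
  then have sig: "(\<lambda>(p, k). norm (g (p ^ Suc k))) summable_on ({p. prime p} \<times> UNIV)"
    by (subst (asm) summable_on_reindex[OF inj]) (simp add: o_def case_prod_unfold)
  have inner: "(\<lambda>k. norm (g (p ^ Suc k))) summable_on UNIV" if "prime p" for p
  proof -
    have "inj (\<lambda>k. p ^ Suc k)"
      using that by (intro injI) (simp add: prime_power_inj'' del: power_Suc)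
    then have "(\<lambda>n. norm (g n)) summable_on range (\<lambda>k. p ^ Suc k) \<longleftrightarrow> (\<lambda>k. norm (g (p ^ Suc k))) summable_on UNIV"
      by (subst summable_on_reindex) (simp_all only: o_def)
    moreover have "(\<lambda>n. norm (g n)) summable_on range (\<lambda>k. p ^ Suc k)"
      using that by (intro multiplicative_abs_summable_on) (auto simp: Suc_le_eq prime_gt_0_nat)
    ultimately show ?thesis by simp
  qed
  have outer: "(\<lambda>p. \<Sum>\<^sub>\<infinity>k. norm (g (p ^ Suc k))) summable_on {p. prime p}"
    using summable_on_Sigma_banach[of "\<lambda>p k. norm (g (p ^ Suc k))" "{p. prime p}" "\<lambda>_. UNIV"] sig by simp
  have bound: "norm ((\<Sum>k. g (p ^ k)) - 1) \<le> (\<Sum>\<^sub>\<infinity>k. norm (g (p ^ Suc k)))" if p: "prime p" for p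
  proof -
    have "summable (\<lambda>k. g (p ^ k))"
      using prime_power_has_sum[OF p] has_sum_imp_sums sums_summable by blast
    then have "(\<Sum>k. g (p ^ k)) - 1 = (\<Sum>k. g (p ^ Suc k))"
      using suminf_split_head[of "\<lambda>k. g (p ^ k)"] g_1 by simp
    moreover have sm: "summable (\<lambda>k. norm (g (p ^ Suc k)))"
      using inner[OF p] by (rule summable_on_imp_summable)
    moreover have "(\<Sum>k. norm (g (p ^ Suc k))) = (\<Sum>\<^sub>\<infinity>k. norm (g (p ^ Suc k)))"
      using has_sum_imp_sums[OF has_sum_infsum[OF inner[OF p]]] by (rule sums_unique[symmetric])
    ultimately show ?thesis using summable_norm[OF sm] by (simp only:)
  qed
  have "(\<lambda>p. norm ((if prime p then \<Sum>k. g (p ^ k) else 1) - 1)) summable_on {p. prime p}"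
    by (rule summable_on_comparison_test[OF outer]) (use bound in auto)
  then have "(\<lambda>p. norm ((if prime p then \<Sum>k. g (p ^ k) else 1) - 1)) summable_on UNIV"
    by (rule summable_on_cong_neutral[THEN iffD1, rotated 3]) auto
  then show ?thesis by (rule summable_on_imp_summable)
qed

text \<open>
  The numbers up to \<open>n\<close> have only prime factors up to \<open>n\<close>, so the finite product differs from the
  whole series by no more than the tail of the series of norms.
\<close>

lemma prod_euler_factors_tendsto:
  "(\<lambda>n. \<Prod>p\<le>n. if prime p then \<Sum>k. g (p ^ k) else 1) \<longlonglongrightarrow> (\<Sum>n. g (Suc n))"
proof -
  let ?P = "\<lambda>n. {p. p \<le> n \<and> prime p}"
  let ?S = "\<lambda>n. smooth_numbers (?P n)"
  let ?tot = "\<Sum>n. norm (g (Suc n))"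
  have S: "?S n \<subseteq> {1..}" for n by (auto simp: smooth_numbers_def)
  have sub: "Suc ` {..<n} \<subseteq> ?S n" for n
    by (auto simp: smooth_numbers_def in_prime_factors_iff dest!: dvd_imp_le)
  have total: "infsum g {1..} = (\<Sum>n. g (Suc n))"
    unfolding range_Suc_eq[symmetric] using norm_summable_imp_has_sum[OF g_summable] summable_norm_cancel[OF g_summable]
    by (subst infsum_reindex) (auto simp: o_def summable_sums intro!: infsumI)
  have norm_total: "infsum (\<lambda>n. norm (g n)) {1..} = ?tot"
    unfolding range_Suc_eq[symmetric] using norm_summable_imp_has_sum[of "\<lambda>n. norm (g (Suc n))"] g_summable
    by (subst infsum_reindex) (auto simp: o_def summable_sums intro!: infsumI)
  have prod: "(\<Prod>p\<le>n. if prime p then \<Sum>k. g (p ^ k) else 1) = infsum g (?S n)" for n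
  proof -
    have "(g has_sum (\<Prod>p\<in>?P n. \<Sum>k. g (p ^ k))) (?S n)"
      by (rule has_sum_smooth_numbers) auto
    then have "infsum g (?S n) = (\<Prod>p\<in>?P n. \<Sum>k. g (p ^ k))" by (rule infsumI)
    also have "\<dots> = (\<Prod>p\<le>n. if prime p then \<Sum>k. g (p ^ k) else 1)"
      by (rule prod.mono_neutral_cong_left) auto
    finally show ?thesis by simp
  qed
  have bound: "norm ((\<Sum>n. g (Suc n)) - infsum g (?S n)) \<le> ?tot - (\<Sum>m<n. norm (g (Suc m)))" for n
  proof -
    have "(\<Sum>n. g (Suc n)) - infsum g (?S n) = infsum g ({1..} - ?S n)"
      unfolding total[symmetric] using S by (intro infsum_Diff[symmetric] multiplicative_summable_on) auto
    also have "norm \<dots> \<le> infsum (\<lambda>n. norm (g n)) ({1..} - ?S n)"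
      by (intro norm_infsum_bound multiplicative_abs_summable_on) auto
    also have "\<dots> = ?tot - infsum (\<lambda>n. norm (g n)) (?S n)"
      unfolding norm_total[symmetric] using S by (intro infsum_Diff multiplicative_abs_summable_on) auto
    also have "(\<Sum>m<n. norm (g (Suc m))) = (\<Sum>m\<in>Suc ` {..<n}. norm (g m))"
      by (subst sum.reindex) auto
    then have "?tot - infsum (\<lambda>n. norm (g n)) (?S n) \<le> ?tot - (\<Sum>m<n. norm (g (Suc m)))"
      using finite_sum_le_infsum[OF multiplicative_abs_summable_on[OF S] _ sub] by simp
    finally show ?thesis .
  qed
  have "(\<lambda>n. ?tot - (\<Sum>m<n. norm (g (Suc m)))) \<longlonglongrightarrow> ?tot - ?tot"
    by (intro tendsto_intros summable_LIMSEQ g_summable)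
  then have "(\<lambda>n. ?tot - (\<Sum>m<n. norm (g (Suc m)))) \<longlonglongrightarrow> 0"
    unfolding diff_self .
  then have "(\<lambda>n. (\<Sum>n. g (Suc n)) - infsum g (?S n)) \<longlonglongrightarrow> 0"
    by (rule Lim_null_comparison[OF always_eventually[OF allI[OF bound]]])
  then have "(\<lambda>n. (\<Sum>n. g (Suc n)) - ((\<Sum>n. g (Suc n)) - infsum g (?S n))) \<longlonglongrightarrow> (\<Sum>n. g (Suc n)) - 0"
    by (intro tendsto_intros)
  then show ?thesis unfolding prod by simp
qed

lemma euler_product_multiplicative:
  "has_prime_prod (\<lambda>p. \<Sum>k. g (p ^ k)) (\<Sum>n. g (Suc n))"
proof -
  let ?F = "\<lambda>p. if prime p then \<Sum>k. g (p ^ k) else 1"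
  have "convergent_prod ?F"
    using summable_imp_abs_convergent_prod[OF summable_euler_factors_minus_1]
    by (rule abs_convergent_prod_imp_convergent_prod)
  then have "?F has_prod prodinf ?F" and lim: "(\<lambda>n. \<Prod>p\<le>n. ?F p) \<longlonglongrightarrow> prodinf ?F"
    by (rule convergent_prod_has_prod, rule convergent_prod_LIMSEQ)
  moreover have "prodinf ?F = (\<Sum>n. g (Suc n))"
    using lim prod_euler_factors_tendsto by (rule LIMSEQ_unique)
  ultimately show ?thesis unfolding has_prime_prod_def by simp
qed

end

section \<open>The orbit Dirichlet series of the product map\<close>

text \<open>
  The divisors of \<open>p\<^sup>k\<close> are the lower powers, so the divisor recursion becomes the recursion of
  the Gaussian binomial coefficients in the first argument.
\<close>

lemma of_nat_subgroup_count_prime_power: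
  assumes "prime p"
  shows "of_nat (subgroup_count (Suc l) (p ^ k)) = (gauss_binom (of_nat p) l k :: 'a::comm_ring_1)"
proof (induction l arbitrary: k)
  case 0
  have "p ^ k \<ge> 1" using assms by (simp add: Suc_le_eq prime_gt_0_nat)
  then show ?case by (simp add: subgroup_count_1_left)
next
  case (Suc l)
  have pk: "p ^ k \<ge> 1" using assms by (simp add: Suc_le_eq prime_gt_0_nat)
  have "of_nat (subgroup_count (Suc (Suc l)) (p ^ k)) =
      (of_nat (\<Sum>j\<le>k. p ^ j * subgroup_count (Suc l) (p ^ j)) :: 'a)"
    unfolding subgroup_count_Suc[OF pk] sum_divisors_prime_power[OF assms] ..
  then show ?case by (simp add: Suc.IH gauss_binom_Suc_left)
qed

lemma prod_subgroup_count_le_powr: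
  assumes "e > 0"
  obtains B :: real where "\<And>n. n \<ge> 1 \<Longrightarrow>
    real (\<Prod>i<length lam. subgroup_count (Suc (lam ! i)) n) \<le> B * real n powr (real (sum_list lam) * (1 + e))"
proof -
  obtain C :: real where C: "C \<ge> 0"
    "\<And>n. n \<ge> 1 \<Longrightarrow> real (\<Sum>d | d dvd n. d) \<le> C * real n powr (1 + e)"
    using sum_divisors_le_powr[OF assms] by blast
  have "real (\<Prod>i<length lam. subgroup_count (Suc (lam ! i)) n)
      \<le> C ^ sum_list lam * real n powr (real (sum_list lam) * (1 + e))" if n: "n \<ge> 1" for n
  proof -
    have "real (\<Prod>i<length lam. subgroup_count (Suc (lam ! i)) n) \<le>
        (\<Prod>i<length lam. (C * real n powr (1 + e)) ^ (lam ! i))"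
      unfolding of_nat_prod using subgroup_count_le_power[OF C assms n] by (intro prod_mono) auto
    also have "\<dots> = (C * real n powr (1 + e)) ^ sum_list lam"
      by (simp add: power_sum[symmetric] sum_list_sum_nth atLeast0LessThan)
    also have "\<dots> = C ^ sum_list lam * real n powr (real (sum_list lam) * (1 + e))"
      using n by (simp add: power_mult_distrib powr_power)
    finally show ?thesis .
  qed
  then show ?thesis using that by blast
qed

text \<open>
  With \<open>N\<close> the sum of the parts, the hypothesis bounds \<open>a n\<close> by a multiple of \<open>n\<close> to the power
  \<open>N - 1 + N e\<close>, for every \<open>e > 0\<close>; this suffices for \<open>Re s > N\<close>.
\<close>

lemma summable_dirichlet_terms:
  fixes a :: "nat \<Rightarrow> nat" and s :: complex
  assumes a: "\<And>n. n \<ge> 1 \<Longrightarrow> n * a n \<le> (\<Prod>i<length lam. subgroup_count (Suc (lam ! i)) n)"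
    and s: "Re s > real (sum_list lam)"
  shows "summable (\<lambda>n. norm (of_nat (a (Suc n)) * of_nat (Suc n) powr (- s)))"
proof -
  let ?N = "real (sum_list lam)"
  \<comment> \<open>The choice makes \<open>N e\<close> smaller than \<open>Re s - N\<close>, also for \<open>N = 0\<close>.\<close>
  define e where "e = (Re s - ?N) / (?N + 1)"
  have N0: "?N \<ge> 0" by simp
  then have e: "e > 0" unfolding e_def using s by (intro divide_pos_pos) linarith+
  have "?N * e < (?N + 1) * e" using e by simp
  also have "(?N + 1) * e = Re s - ?N" unfolding e_def using N0 by simp
  finally have exponent: "?N * (1 + e) - 1 - Re s < - 1" by (simp add: algebra_simps)
  obtain B :: real where B: "\<And>n. n \<ge> 1 \<Longrightarrow>
      real (\<Prod>i<length lam. subgroup_count (Suc (lam ! i)) n) \<le> B * real n powr (?N * (1 + e))"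
    using prod_subgroup_count_le_powr[OF e] by blast
  have bound: "norm (of_nat (a n) * of_nat n powr (- s) :: complex) \<le> B * real n powr (?N * (1 + e) - 1 - Re s)"
    if n: "n \<ge> 1" for n
  proof -
    have "real n * real (a n) \<le> B * real n powr (?N * (1 + e))"
      using order_trans[OF of_nat_mono[OF a[OF n]] B[OF n]] by simp
    then have "real (a n) \<le> B * real n powr (?N * (1 + e)) / real n"
      using n by (simp add: field_simps)
    then have "real (a n) * real n powr (- Re s) \<le> B * real n powr (?N * (1 + e)) / real n * real n powr (- Re s)"
      by (intro mult_right_mono) auto
    also have "\<dots> = B * real n powr (?N * (1 + e) - 1 - Re s)"
      using n by (simp add: powr_diff powr_minus powr_add field_simps)
    finally show ?thesis
      by (simp add: norm_mult norm_powr_real_powr)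
  qed
  have "summable (\<lambda>n. B * real n powr (?N * (1 + e) - 1 - Re s))"
    using exponent by (intro summable_mult) (simp add: summable_real_powr_iff)
  then have "summable (\<lambda>n. B * real (Suc n) powr (?N * (1 + e) - 1 - Re s))"
    by (subst summable_Suc_iff)
  then show ?thesis
    by (rule summable_comparison_test'[of _ 0]) (use bound[of "Suc _"] in simp)
qed

definition word_multiset :: "nat list \<Rightarrow> nat multiset" where
  "word_multiset lam = (\<Sum>i = 1..length lam. replicate_mset (lam ! (i - 1)) i)"

lemma count_word_multiset:
  "count (word_multiset lam) i = (if i \<in> {1..length lam} then lam ! (i - 1) else 0)"
  by (auto simp: word_multiset_def count_sum sum.If_cases Int_def)

lemma set_word_multiset: "set_mset (word_multiset lam) \<subseteq> {1..length lam}"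
  using count_word_multiset[of lam] by (metis count_eq_zero_iff subsetI)

lemma length_multiset_words:
  assumes "w \<in> multiset_words lam"
  shows "length w = sum_list lam"
proof -
  have "length w = size (word_multiset lam)"
    using assms by (auto simp: multiset_words_def word_multiset_def permutations_of_multiset_def
        size_mset[symmetric] simp del: size_mset)
  also have "\<dots> = (\<Sum>i = 1..length lam. lam ! (i - 1))"
    by (simp add: word_multiset_def size_multiset_sum)
  also have "\<dots> = sum_list lam"
    by (simp add: sum_list_sum_nth atLeast0LessThan sum.atLeast1_atMost_eq)
  finally show ?thesis .
qed

text \<open>
  MacMahon's identity for the joint distribution of \<open>des\<close> and \<open>maj\<close> on multiset permutations.
\<close>

lemma prod_gauss_binom_generating_function:
  fixes q x :: complex
  assumes "\<And>i. i \<le> sum_list lam \<Longrightarrow> norm (x * q ^ i) < 1"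
  shows "(\<lambda>k. (\<Prod>i<length lam. gauss_binom q (lam ! i) k) * x ^ k) sums
           (C_poly lam x q / (\<Prod>i\<le>sum_list lam. 1 - x * q ^ i))"
proof -
  have eq: "(\<Prod>i<length lam. gauss_binom q (lam ! i) k) = (\<Sum>w\<in>multiset_words lam. block_sum q k w)" for k
  proof -
    have "(\<Sum>w\<in>multiset_words lam. block_sum q k w) =
        (\<Prod>i\<in>{1..length lam}. gauss_binom q (count (word_multiset lam) i) k)"
      unfolding multiset_words_def word_multiset_def[symmetric]
      by (rule sum_block_sum_eq_prod_gauss_binom[OF _ set_word_multiset]) simp
    also have "\<dots> = (\<Prod>i\<in>{1..length lam}. gauss_binom q (lam ! (i - 1)) k)"
      by (intro prod.cong refl) (simp add: count_word_multiset)
    also have "\<dots> = (\<Prod>i<length lam. gauss_binom q (lam ! i) k)"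
      by (simp add: prod.atLeast1_atMost_eq)
    finally show ?thesis ..
  qed
  have "(\<lambda>k. \<Sum>w\<in>multiset_words lam. block_sum q k w * x ^ k) sums
      (\<Sum>w\<in>multiset_words lam. x ^ des w * q ^ maj w / (\<Prod>i\<le>sum_list lam. 1 - x * q ^ i))"
  proof (rule sums_sum)
    fix w assume "w \<in> multiset_words lam"
    then have len: "length w = sum_list lam" by (rule length_multiset_words)
    show "(\<lambda>k. block_sum q k w * x ^ k) sums (x ^ des w * q ^ maj w / (\<Prod>i\<le>sum_list lam. 1 - x * q ^ i))"
      using block_sum_generating_function[of w x q] assms unfolding len by blast
  qed
  then show ?thesis
    unfolding eq C_poly_def by (simp only: sum_distrib_right sum_divide_distrib)
qed

lemma of_nat_mult_powr: "(of_nat (m * n) :: complex) powr z = of_nat m powr z * of_nat n powr z"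
  by (simp add: powr_times_real)

lemma of_nat_power_powr:
  "p > 0 \<Longrightarrow> (of_nat (p ^ k) :: complex) powr z = (of_nat p powr z) ^ k"
  by (induction k) (simp_all add: powr_times_real)

text \<open>
  With \<open>x\<close> the value of \<open>p\<close> to the power \<open>- 1 - s\<close>, the \<open>k\<close>-th term is \<open>x\<^sup>k\<close> times \<open>p\<^sup>k a (p\<^sup>k)\<close>,
  a difference of consecutive products of Gaussian binomial coefficients. Taking differences
  multiplies the generating function by \<open>1 - x\<close>, which cancels the factor with \<open>i = 0\<close> of the
  denominator in MacMahon's identity.
\<close>

lemma euler_factor_of_sum_divisors:
  fixes a :: "nat \<Rightarrow> nat" and s :: complex
  assumes a: "\<And>k. (\<Sum>d | d dvd p ^ k. d * a d) = (\<Prod>i<length lam. subgroup_count (Suc (lam ! i)) (p ^ k))"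
    and p: "prime p" and s: "Re s > real (sum_list lam)"
  shows "(\<lambda>k. of_nat (a (p ^ k)) * of_nat (p ^ k) powr (- s)) sums
    (C_poly lam (of_nat p powr (- 1 - s)) (of_nat p)
      / (\<Prod>i = 1..sum_list lam. 1 - of_nat p powr (of_nat i - 1 - s)))"
proof -
  let ?N = "sum_list lam"
  define q where "q = (of_nat p :: complex)"
  define x where "x = q powr (- 1 - s)"
  define F where "F k = (\<Prod>i<length lam. gauss_binom q (lam ! i) k)" for k
  have p0: "p > 0" "p \<ge> 2" and q0: "q \<noteq> 0"
    using p by (auto simp: q_def prime_gt_0_nat prime_ge_2_nat)
  have xq: "x * q ^ i = q powr (of_nat i - 1 - s)" for i
  proof -
    have "x * q ^ i = q powr (- 1 - s) * q powr of_nat i" using q0 by (simp add: x_def)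
    also have "\<dots> = q powr (of_nat i - 1 - s)" by (simp add: powr_add[symmetric] algebra_simps)
    finally show ?thesis .
  qed
  have small: "norm (x * q ^ i) < 1" if "i \<le> ?N" for i
  proof -
    have "norm (x * q ^ i) = real p powr (real i - 1 - Re s)"
      unfolding xq by (simp add: q_def norm_powr_real_powr)
    also have "\<dots> < real p powr 0"
      using s that p0 by (intro powr_less_mono) auto
    finally show ?thesis using p0 by simp
  qed
  have x1: "norm x < 1" using small[of 0] by simp
  have partial: "(\<Sum>j\<le>k. of_nat (p ^ j * a (p ^ j))) = F k" for k
    using a[of k] unfolding sum_divisors_prime_power[OF p] F_def q_def
      of_nat_subgroup_count_prime_power[OF p, symmetric] of_nat_prod[symmetric] of_nat_sum[symmetric]
    by simp
  have term_eq: "of_nat (a (p ^ k)) * of_nat (p ^ k) powr (- s) =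
      F k * x ^ k - (if k = 0 then 0 else x * (F (k - 1) * x ^ (k - 1)))" for k
  proof -
    have "q powr (- s) = q powr (1 + (- 1 - s))" by simp
    also have "\<dots> = q * x" unfolding powr_add x_def by simp
    finally have "of_nat (p ^ k) powr (- s) = q ^ k * x ^ k"
      using p0 unfolding of_nat_power_powr[OF p0(1)] q_def[symmetric] by (simp add: power_mult_distrib)
    moreover have "of_nat (a (p ^ k)) * q ^ k = F k - (if k = 0 then 0 else F (k - 1))"
      by (cases k) (simp_all add: partial[symmetric] q_def)
    ultimately have "of_nat (a (p ^ k)) * of_nat (p ^ k) powr (- s) =
        (F k - (if k = 0 then 0 else F (k - 1))) * x ^ k"
      by (simp only: mult.assoc[symmetric])
    then show ?thesis
      by (cases k) (simp_all add: algebra_simps)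
  qed
  define S where "S = C_poly lam x q / (\<Prod>i\<le>?N. 1 - x * q ^ i)"
  have S: "(\<lambda>k. F k * x ^ k) sums S"
    unfolding F_def S_def using small by (rule prod_gauss_binom_generating_function)
  have "(\<lambda>k. if k = 0 then 0 else x * (F (k - 1) * x ^ (k - 1))) sums (x * S)"
    using sums_mult[OF S, of x]
      sums_Suc_iff[of "\<lambda>k. if k = 0 then 0 else x * (F (k - 1) * x ^ (k - 1))" "x * S"] by simp
  then have "(\<lambda>k. of_nat (a (p ^ k)) * of_nat (p ^ k) powr (- s)) sums (S - x * S)"
    unfolding term_eq by (intro sums_diff S)
  also have "S - x * S = (1 - x) * S" by (simp add: algebra_simps)
  also have "\<dots> = C_poly lam x q / (\<Prod>i = 1..?N. 1 - x * q ^ i)"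
  proof -
    have "(\<Prod>i\<le>?N. 1 - x * q ^ i) = (1 - x) * (\<Prod>i = 1..?N. 1 - x * q ^ i)"
      by (simp add: atMost_atLeast0 prod.atLeast_Suc_atMost)
    moreover have "1 - x \<noteq> 0" using x1 by auto
    ultimately show ?thesis by (simp add: S_def)
  qed
  finally show ?thesis unfolding xq unfolding x_def q_def .
qed

text \<open>
  Periodic points of the product are counted by products of subgroup counts; the rest concerns the
  arithmetic function \<open>a\<close> with these divisor sums.
\<close>

theorem theorem1p1:
  fixes X :: "nat \<Rightarrow> 'a set" and T :: "nat \<Rightarrow> 'a \<Rightarrow> 'a"
    and lam :: "nat list" and N :: nat and s :: complex
  assumes maps: "\<And>r. r \<ge> 1 \<Longrightarrow> T r \<in> X r \<rightarrow> X r"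
    and finite_orbits: "\<And>r n. r \<ge> 1 \<Longrightarrow> n \<ge> 1 \<Longrightarrow> finite (closed_orbits (X r) (T r) n)"
    and orbits: "\<And>r n. r \<ge> 1 \<Longrightarrow> n \<ge> 1 \<Longrightarrow> orbit_count (X r) (T r) n = subgroup_count r n"
    and partition: "is_partition lam N"
    and s: "Re s > real N"
  shows "(\<forall>n\<ge>1. finite (closed_orbits (product_space X lam) (product_map T lam) n))
    \<and> summable (\<lambda>n. norm (orbit_dirichlet_term (product_space X lam) (product_map T lam) s (Suc n)))
    \<and> has_prime_prod
        (\<lambda>p. C_poly lam (of_nat p powr (- 1 - s)) (of_nat p)
             / (\<Prod>i = 1..N. 1 - of_nat p powr (of_nat i - 1 - s)))
        (orbit_dirichlet_series (product_space X lam) (product_map T lam) s)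
    \<and> has_prime_prod
        (\<lambda>p. (\<Sum>w\<in>multiset_words lam. of_nat p powr ((- 1 - s) * of_nat (des w) + of_nat (maj w)))
             / (\<Prod>i = 1..N. 1 - of_nat p powr (of_nat i - 1 - s)))
        (orbit_dirichlet_series (product_space X lam) (product_map T lam) s)"
proof -
  let ?X = "product_space X lam" and ?T = "product_map T lam"
  define a where "a = orbit_count ?X ?T"
  define F where "F n = (\<Prod>i<length lam. subgroup_count (Suc (lam ! i)) n)" for n
  have parts: "r \<ge> 1" if "r \<in> set lam" for r
    using partition that by (auto simp: is_partition_def)
  have N: "N = sum_list lam" using partition by (simp add: is_partition_def)
  have T: "?T \<in> ?X \<rightarrow> ?X"
    by (rule product_map_in_product_space) (use maps parts in blast)

  have periodic: "finite (periodic_points (X r) (T r) n)"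
    "card (periodic_points (X r) (T r) n) = subgroup_count (Suc r) n" if "r \<ge> 1" "n \<ge> 1" for r n
  proof -
    have "card (periodic_points (X r) (T r) n) = (\<Sum>d | d dvd n. d * orbit_count (X r) (T r) d)"
      using that by (intro card_periodic_points maps finite_orbits)
    also have "\<dots> = (\<Sum>d | d dvd n. d * subgroup_count r d)"
      using that by (intro sum.cong refl) (metis (mono_tags) dvd_0_left less_one mem_Collect_eq not_le orbits)
    finally show "card (periodic_points (X r) (T r) n) = subgroup_count (Suc r) n"
      using subgroup_count_Suc that by simp
    show "finite (periodic_points (X r) (T r) n)"
      using that by (intro card_periodic_points maps finite_orbits)
  qed
  have fin_prod: "finite (periodic_points ?X ?T n)" if "n \<ge> 1" for n
    unfolding periodic_points_product using periodic(1) parts that by (intro finite_PiE) auto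
  have fin: "finite (closed_orbits ?X ?T n)" if "n \<ge> 1" for n
    using T that fin_prod[OF that] by (rule finite_closed_orbits_if_finite_periodic_points)
  have sum_a: "(\<Sum>d | d dvd n. d * a d) = F n" if n: "n \<ge> 1" for n
  proof -
    have "(\<Sum>d | d dvd n. d * a d) = card (periodic_points ?X ?T n)"
      unfolding a_def using card_periodic_points(2)[OF T n fin] by simp
    also have "\<dots> = (\<Prod>i<length lam. card (periodic_points (X (lam ! i)) (T (lam ! i)) n))"
      unfolding periodic_points_product by (simp add: card_PiE)
    also have "\<dots> = F n"
      unfolding F_def using periodic(2) parts n by (intro prod.cong refl) simp
    finally show ?thesis .
  qed

  have a_mult: "a (m * n) = a m * a n" if "coprime m n" "m \<ge> 1" "n \<ge> 1" for m n
  proof -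
    have "(m * n) * a (m * n) = (m * a m) * (n * a n)"
    proof (rule multiplicative_of_sum_divisors_multiplicative[OF _ that])
      fix k l :: nat assume kl: "coprime k l" "k \<ge> 1" "l \<ge> 1"
      then have "k * l \<ge> 1" by simp
      then show "(\<Sum>d | d dvd k * l. d * a d) = (\<Sum>d | d dvd k. d * a d) * (\<Sum>d | d dvd l. d * a d)"
        using kl by (simp only: sum_a) (simp add: F_def subgroup_count_multiplicative prod.distrib)
    qed
    then show ?thesis using that by simp
  qed
  have a_1: "a 1 = 1" using sum_a[of 1] by (simp add: F_def)
  have a_le: "n * a n \<le> F n" if "n \<ge> 1" for n
    using sum_a[OF that] member_le_sum[of n "{d. d dvd n}" "\<lambda>d. d * a d"] that by simp

  define g where "g n = of_nat (a n) * (of_nat n :: complex) powr (- s)" for n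
  have g: "orbit_dirichlet_term ?X ?T s = g"
    by (simp add: fun_eq_iff orbit_dirichlet_term_def g_def a_def)
  have summ: "summable (\<lambda>n. norm (g (Suc n)))"
    unfolding g_def using a_le s unfolding F_def N by (rule summable_dirichlet_terms)
  have factor: "(\<Sum>k. g (p ^ k)) = C_poly lam (of_nat p powr (- 1 - s)) (of_nat p)
      / (\<Prod>i = 1..N. 1 - of_nat p powr (of_nat i - 1 - s))" if p: "prime p" for p
  proof -
    have "p ^ k \<ge> 1" for k using p by (simp add: Suc_le_eq prime_gt_0_nat)
    then have "(\<lambda>k. g (p ^ k)) sums (C_poly lam (of_nat p powr (- 1 - s)) (of_nat p)
        / (\<Prod>i = 1..N. 1 - of_nat p powr (of_nat i - 1 - s)))"
      unfolding g_def N using sum_a p s unfolding F_def N by (intro euler_factor_of_sum_divisors) auto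
    then show ?thesis by (rule sums_unique[symmetric])
  qed
  have "has_prime_prod (\<lambda>p. \<Sum>k. g (p ^ k)) (\<Sum>n. g (Suc n))"
    using _ _ summ
  proof (rule euler_product_multiplicative)
    show "g 1 = 1" using a_1 by (simp add: g_def)
    show "g (m * n) = g m * g n" if "coprime m n" "m \<ge> 1" "n \<ge> 1" for m n
      unfolding g_def of_nat_mult_powr a_mult[OF that] by simp
  qed
  moreover have "(\<lambda>p. if prime p then \<Sum>k. g (p ^ k) else 1) =
      (\<lambda>p. if prime p then C_poly lam (of_nat p powr (- 1 - s)) (of_nat p)
        / (\<Prod>i = 1..N. 1 - of_nat p powr (of_nat i - 1 - s)) else 1)"
    using factor by auto
  ultimately have prod: "has_prime_prod
        (\<lambda>p. C_poly lam (of_nat p powr (- 1 - s)) (of_nat p)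
             / (\<Prod>i = 1..N. 1 - of_nat p powr (of_nat i - 1 - s))) (orbit_dirichlet_series ?X ?T s)"
    unfolding has_prime_prod_def orbit_dirichlet_series_def g by simp
  have "(of_nat p powr (- 1 - s)) ^ des w * of_nat p ^ maj w =
      (of_nat p :: complex) powr ((- 1 - s) * of_nat (des w) + of_nat (maj w))" if "prime p" for p w
    using prime_gt_0_nat[OF that] by (simp add: powr_add powr_power mult.commute)
  then have "(\<lambda>p. if prime p then C_poly lam (of_nat p powr (- 1 - s)) (of_nat p)
        / (\<Prod>i = 1..N. 1 - of_nat p powr (of_nat i - 1 - s)) else 1) =
      (\<lambda>p. if prime p then (\<Sum>w\<in>multiset_words lam. of_nat p powr ((- 1 - s) * of_nat (des w) + of_nat (maj w)))
        / (\<Prod>i = 1..N. 1 - of_nat p powr (of_nat i - 1 - s)) else 1)"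
    unfolding C_poly_def by (simp cong: if_cong)
  with prod have "has_prime_prod
        (\<lambda>p. (\<Sum>w\<in>multiset_words lam. of_nat p powr ((- 1 - s) * of_nat (des w) + of_nat (maj w)))
             / (\<Prod>i = 1..N. 1 - of_nat p powr (of_nat i - 1 - s))) (orbit_dirichlet_series ?X ?T s)"
    unfolding has_prime_prod_def by simp
  then show ?thesis using fin summ prod unfolding g by blast
qed

end
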